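(* Let $G$ be a finite graph with $n$ nodes $v_1,\dots,v_n$. The convex hull of the points $c(M_G)$ in $\mathbb{R}^n$ yields the graph multiplihedron $\mathcal{J}G$; that is, it is a convex polytope whose face poset is isomorphic to the poset of marked tubings of $G$ under $\preceq$.
   Context: Graphs are finite, simple, with at least one node. A tube of $G$ is a nonempty set of nodes whose induced subgraph is connected; in addition, the set of all nodes of $G$ (whether or not $G$ is connected) is considered a tube, called the universal tube. Two distinct tubes $u_1,u_2$ intersect if $u_1\cap u_2\ne\emptyset$, $u_1\not\subset u_2$ and $u_2\not\subset u_1$; they are adjacent if $u_1\cap u_2=\emptyset$ and $u_1\cup u_2$ is a tube; they are compatible if they neither intersect nor are adjacent. A tubing of $G$ is a set of pairwise compatible tubes of $G$ that contains the universal tube and, if $G$ is disconnected, does not contain all of the tubes given by the node sets of the connected components of $G$. A marked tubing of $G$ is a tubing together with an assignment to each of its tubes of exactly one of the markings thin, thick, broken, such that whenever $u\subsetneq v$ are tubes of the tubing and $v$ is not thick, then $u$ is thin. In a tubing, $u$ is closely nested in $v$, written $u\Subset v$, if $u\subsetneq v$ and no tube $u'$ of the tubing satisfies $u\subsetneq u'\subsetneq v$. Order on marked tubings: $U\preceq U'$ if $U$ is obtained from $U'$ by a finite (possibly empty) sequence of the following moves, each producing again a marked tubing: (1) a broken tube becomes thin or becomes thick; (2) a thin tube is added inside a thin tube or inside a broken tube; (3) a thick tube is added inside a thick tube; (4) a nonempty collection of compatible broken tubes $\{u_1,\dots,u_m\}$ is added simultaneously inside a broken tube $v$, with $u_i\Subset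 v$ for all $i$ in the resulting tubing, and at the same time $v$ becomes thick. The face poset of a polytope is the set of its nonempty faces (including the polytope itself) ordered by inclusion. $M_G$ is the set of maximal marked tubings of $G$: those with exactly $n$ tubes, each thin or thick. For $U\in M_G$ and a node $v$, let $\varepsilon(v)$ be the smallest tube of $U$ containing $v$, and set $$f_U(v)=3^{|\varepsilon(v)|-1}-\sum_{s\Subset\varepsilon(v)}3^{|s|-1},$$ the sum being over tubes $s$ of $U$ closely nested in $\varepsilon(v)$. The map $c:M_G\to\mathbb{R}^n$ sends $U$ to $(x_1,\dots,x_n)$ with $x_i=f_U(v_i)$ if $\varepsilon(v_i)$ is thin and $x_i=3f_U(v_i)$ if $\varepsilon(v_i)$ is thick. *)

theory Defs
  imports "HOL-Analysis.Analysis"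
begin

text \<open>
  A graph on the node type \<open>'n\<close> is given by its adjacency relation; it is simple when the
  relation is symmetric and irreflexive. The nodes are indexed by a finite type, so that
  \<open>n = CARD('n)\<close> and the points below live in \<open>real ^ 'n\<close>.
\<close>

definition simple_graph :: "('n::finite \<Rightarrow> 'n \<Rightarrow> bool) \<Rightarrow> bool" where
  "simple_graph E \<longleftrightarrow> symp E \<and> irreflp E"

definition connected_on :: "('n \<Rightarrow> 'n \<Rightarrow> bool) \<Rightarrow> 'n set \<Rightarrow> bool" where
  "connected_on E S \<longleftrightarrow>
     S \<noteq> {} \<and> (\<forall>x\<in>S. \<forall>y\<in>S. (\<lambda>a b. E a b \<and> a \<in> S \<and> b \<in> S)\<^sup>*\<^sup>* x y)"

definition connected_components :: "('n \<Rightarrow> 'n \<Rightarrow> bool) \<Rightarrow> 'n set set" where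
  "connected_components E = {{y. E\<^sup>*\<^sup>* x y} | x. True}"

definition tube :: "('n \<Rightarrow> 'n \<Rightarrow> bool) \<Rightarrow> 'n set \<Rightarrow> bool" where
  "tube E u \<longleftrightarrow> connected_on E u \<or> u = UNIV"

definition tubes_intersect :: "'n set \<Rightarrow> 'n set \<Rightarrow> bool" where
  "tubes_intersect u v \<longleftrightarrow> u \<inter> v \<noteq> {} \<and> \<not> u \<subset> v \<and> \<not> v \<subset> u"

definition tubes_adjacent :: "('n \<Rightarrow> 'n \<Rightarrow> bool) \<Rightarrow> 'n set \<Rightarrow> 'n set \<Rightarrow> bool" where
  "tubes_adjacent E u v \<longleftrightarrow> u \<inter> v = {} \<and> tube E (u \<union> v)"

text \<open>Only meant for distinct tubes; below it is used under \<^const>\<open>pairwise\<close>.\<close>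

definition compatible :: "('n \<Rightarrow> 'n \<Rightarrow> bool) \<Rightarrow> 'n set \<Rightarrow> 'n set \<Rightarrow> bool" where
  "compatible E u v \<longleftrightarrow> \<not> tubes_intersect u v \<and> \<not> tubes_adjacent E u v"

definition tubing :: "('n \<Rightarrow> 'n \<Rightarrow> bool) \<Rightarrow> 'n set set \<Rightarrow> bool" where
  "tubing E T \<longleftrightarrow>
     (\<forall>u\<in>T. tube E u) \<and> pairwise (compatible E) T \<and> UNIV \<in> T \<and>
     (\<not> connected_on E UNIV \<longrightarrow> \<not> connected_components E \<subseteq> T)"

datatype marking = Thin | Thick | Broken

text \<open>A tubing with marked tubes is a finite map whose domain is the underlying tubing.\<close>

type_synonym 'n marked = "'n set \<rightharpoonup> marking"

definition marked_tubing :: "('n \<Rightarrow> 'n \<Rightarrow> bool) \<Rightarrow> 'n marked \<Rightarrow> bool" where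
  "marked_tubing E U \<longleftrightarrow>
     tubing E (dom U) \<and>
     (\<forall>u\<in>dom U. \<forall>v\<in>dom U. u \<subset> v \<and> U v \<noteq> Some Thick \<longrightarrow> U u = Some Thin)"

definition closely_nested :: "'n set set \<Rightarrow> 'n set \<Rightarrow> 'n set \<Rightarrow> bool" where
  "closely_nested T u v \<longleftrightarrow>
     u \<in> T \<and> v \<in> T \<and> u \<subset> v \<and> \<not> (\<exists>w\<in>T. u \<subset> w \<and> w \<subset> v)"

text \<open>\<open>tubing_move E U' U\<close>: the marked tubing \<open>U\<close> results from \<open>U'\<close> by a single move.\<close>

inductive tubing_move ::
  "('n \<Rightarrow> 'n \<Rightarrow> bool) \<Rightarrow> 'n marked \<Rightarrow> 'n marked \<Rightarrow> bool" for E U' where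
  resolve:
    "\<lbrakk>U' u = Some Broken; m = Thin \<or> m = Thick; marked_tubing E (U'(u \<mapsto> m))\<rbrakk>
      \<Longrightarrow> tubing_move E U' (U'(u \<mapsto> m))"
| add_thin:
    "\<lbrakk>u \<notin> dom U'; u \<subset> v; U' v = Some Thin \<or> U' v = Some Broken;
      marked_tubing E (U'(u \<mapsto> Thin))\<rbrakk>
      \<Longrightarrow> tubing_move E U' (U'(u \<mapsto> Thin))"
| add_thick:
    "\<lbrakk>u \<notin> dom U'; u \<subset> v; U' v = Some Thick; marked_tubing E (U'(u \<mapsto> Thick))\<rbrakk>
      \<Longrightarrow> tubing_move E U' (U'(u \<mapsto> Thick))"
| add_broken:
    "\<lbrakk>C \<noteq> {}; C \<inter> dom U' = {}; pairwise (compatible E) C; U' v = Some Broken;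
      U = (\<lambda>t. if t \<in> C then Some Broken else (U'(v \<mapsto> Thick)) t);
      \<forall>u\<in>C. closely_nested (dom U) u v; marked_tubing E U\<rbrakk>
      \<Longrightarrow> tubing_move E U' U"

definition marked_le ::
  "('n \<Rightarrow> 'n \<Rightarrow> bool) \<Rightarrow> 'n marked \<Rightarrow> 'n marked \<Rightarrow> bool" where
  "marked_le E U U' \<longleftrightarrow> (tubing_move E)\<^sup>*\<^sup>* U' U"

definition maximal_marked_tubings :: "('n::finite \<Rightarrow> 'n \<Rightarrow> bool) \<Rightarrow> 'n marked set" where
  "maximal_marked_tubings E =
     {U. marked_tubing E U \<and> card (dom U) = CARD('n) \<and> ran U \<subseteq> {Thin, Thick}}"

text \<open>
  The tubes of a tubing containing a given node form a chain under inclusion that contains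
  \<^term>\<open>UNIV\<close>, so the least one exists.
\<close>

definition smallest_tube :: "'n marked \<Rightarrow> 'n \<Rightarrow> 'n set" where
  "smallest_tube U v = (LEAST t. t \<in> dom U \<and> v \<in> t)"

definition tube_weight :: "'n::finite marked \<Rightarrow> 'n \<Rightarrow> real" where
  "tube_weight U v =
     3 ^ (card (smallest_tube U v) - 1)
       - (\<Sum>s | closely_nested (dom U) s (smallest_tube U v). 3 ^ (card s - 1))"

definition vertex_point :: "'n::finite marked \<Rightarrow> real ^ 'n" where
  "vertex_point U =
     (\<chi> i. if U (smallest_tube U i) = Some Thick then 3 * tube_weight U i
           else tube_weight U i)"

end

theory Submission
  imports Defs
begin

text \<open>
  For \<open>a :: 'n \<Rightarrow> real\<close> let the level tubes of \<open>a\<close> be the connected components of the superlevel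
  sets \<open>{i. s \<le> a i}\<close>, with the universal tube standing for the full set. They form a tubing, and
  marking a level tube thin, broken or thick according to the sign of the minimum of \<open>a\<close> on it gives
  a marked tubing; every marked tubing arises in this way. Let \<open>\<rho> B\<close> be the sum of
  \<open>3 ^ (card t - 1)\<close> over the components \<open>t\<close> of \<open>B\<close>, and let \<open>x(B)\<close> be the sum of the
  coordinates of \<open>x\<close> in \<open>B\<close>. Every vertex \<open>x\<close> satisfies
  \<open>x(B) \<ge> \<rho> B\<close> and \<open>x(- B) \<le> 3 (\<rho> UNIV - \<rho> B)\<close>, and the equality cases are combinatorial.
  Summing these bounds over the superlevel sets (the first for levels \<open>s > 0\<close>, the second for
  \<open>s \<le> 0\<close>) shows that the vertices minimising \<open>a\<close> are exactly those of the maximal marked tubings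
  refining the level marking of \<open>a\<close>. Hence the cones of the normal fan correspond to the marked
  tubings. The order generated by the moves agrees with refinement, and refinement between marked
  tubings is detected by maximal ones because level markings can be perturbed.
\<close>

section \<open>Components and tubings\<close>

text \<open>The bounds hold because the weights of the nodes of a tube \<open>t\<close> of a maximal
  tubing telescope to \<open>3 ^ (card t - 1)\<close>, whereas a tube outside the tubing contains
  the node that the smallest member around it has to itself, and this node alone weighs more. Base 3
  makes that strict: a tube of \<open>l + 2\<close> nodes leaves \<open>l + 1\<close> nodes to its
  subtubes, whose powers add up to at most \<open>3 ^ l\<close>, so its own node weighs at least
  \<open>2 * 3 ^ l\<close>; with base 2 there could be a tie. Strictness is what makes the equality
  cases combinatorial. Two families of bounds occur because a thick mark triples a coordinate: at
  positive levels this costs, so tightness asks for thin; at levels up to 0 it pays, so tightness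
  asks for thick on the complement. A minimum of 0 can be perturbed to either side, which is the
  meaning of broken. For the moves the obstacle is a broken tube that turns thick while the target
  has new non-thick tubes directly inside it: resolving it alone would overshoot, which is the
  purpose of the fourth move.\<close>

definition node_component :: "('n \<Rightarrow> 'n \<Rightarrow> bool) \<Rightarrow> 'n set \<Rightarrow> 'n \<Rightarrow> 'n set" where
  "node_component E B x = {y. (\<lambda>a b. E a b \<and> a \<in> B \<and> b \<in> B)\<^sup>*\<^sup>* x y}"

text \<open>The full set is a single part even if the graph is disconnected, matching the universal
  tube.\<close>

definition parts :: "('n \<Rightarrow> 'n \<Rightarrow> bool) \<Rightarrow> 'n set \<Rightarrow> 'n set set" where
  "parts E B = (if B = UNIV then {UNIV} else node_component E B ` B)"

text \<open>As an intersection this is total and obviously below every member containing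
  \<open>S\<close>; that it is itself a member comes from laminarity
  (\<open>enclosing_mem\<close>).\<close>

definition enclosing :: "'n set set \<Rightarrow> 'n set \<Rightarrow> 'n set" where
  "enclosing T S = \<Inter>{u \<in> T. S \<subseteq> u}"

lemma tube_nonempty: "tube E t \<Longrightarrow> t \<noteq> {}"
  by (auto simp: tube_def connected_on_def)

lemma connected_on_mono_rtranclp:
  assumes "(\<lambda>a b. E a b \<and> a \<in> S \<and> b \<in> S)\<^sup>*\<^sup>* x y" "S \<subseteq> B"
  shows "(\<lambda>a b. E a b \<and> a \<in> B \<and> b \<in> B)\<^sup>*\<^sup>* x y"
  using assms(1) by (rule rtranclp_mono[THEN predicate2D, rotated]) (use assms(2) in auto)

lemma closed_under_rtranclp:
  assumes "r\<^sup>*\<^sup>* x y" "x \<in> u" "\<And>j k. j \<in> u \<Longrightarrow> r j k \<Longrightarrow> k \<in> u"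
  shows "y \<in> u"
  using assms(1,2) by induction (auto intro: assms(3))

lemma connected_on_subset_closed:
  assumes "connected_on E S" "x \<in> S" "x \<in> u"
    and "\<And>j k. j \<in> u \<Longrightarrow> k \<in> S \<Longrightarrow> E j k \<Longrightarrow> k \<in> u"
  shows "S \<subseteq> u"
proof
  fix y assume "y \<in> S"
  then have "(\<lambda>a b. E a b \<and> a \<in> S \<and> b \<in> S)\<^sup>*\<^sup>* x y"
    using assms(1,2) by (auto simp: connected_on_def)
  then show "y \<in> u"
    by (rule closed_under_rtranclp) (use assms in auto)
qed

context
  fixes E :: "'n \<Rightarrow> 'n \<Rightarrow> bool"
  assumes symE: "symp E"
begin

lemma restricted_sym:
  assumes "(\<lambda>a b. E a b \<and> a \<in> B \<and> b \<in> B)\<^sup>*\<^sup>* x y"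
  shows "(\<lambda>a b. E a b \<and> a \<in> B \<and> b \<in> B)\<^sup>*\<^sup>* y x"
proof -
  have "symp (\<lambda>a b. E a b \<and> a \<in> B \<and> b \<in> B)"
    using symE by (auto simp: symp_def)
  from sympD[OF symp_rtranclp[OF this] assms] show ?thesis .
qed

lemma connected_onI:
  assumes "x \<in> S" "\<And>y. y \<in> S \<Longrightarrow> (\<lambda>a b. E a b \<and> a \<in> S \<and> b \<in> S)\<^sup>*\<^sup>* x y"
  shows "connected_on E S"
  unfolding connected_on_def
  using assms restricted_sym by (meson empty_iff rtranclp_trans)

lemma connected_on_Un_edge:
  assumes "connected_on E u" "connected_on E v" "j \<in> u" "k \<in> v" "E j k"
  shows "connected_on E (u \<union> v)"
proof (rule connected_onI)
  show "j \<in> u \<union> v" using assms by simp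
next
  fix y assume y: "y \<in> u \<union> v"
  let ?R = "(\<lambda>a b. E a b \<and> a \<in> u \<union> v \<and> b \<in> u \<union> v)"
  have jk: "?R j k" using assms by auto
  show "?R\<^sup>*\<^sup>* j y"
  proof (cases "y \<in> u")
    case True
    then have "(\<lambda>a b. E a b \<and> a \<in> u \<and> b \<in> u)\<^sup>*\<^sup>* j y"
      using assms by (auto simp: connected_on_def)
    then show ?thesis by (rule connected_on_mono_rtranclp) auto
  next
    case False
    then have "(\<lambda>a b. E a b \<and> a \<in> v \<and> b \<in> v)\<^sup>*\<^sup>* k y"
      using assms y by (auto simp: connected_on_def)
    then have "?R\<^sup>*\<^sup>* k y" by (rule connected_on_mono_rtranclp) auto
    with jk show ?thesis by (rule converse_rtranclp_into_rtranclp)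
  qed
qed

lemma node_component_subset: "x \<in> B \<Longrightarrow> node_component E B x \<subseteq> B"
  unfolding node_component_def by (auto elim: closed_under_rtranclp)

lemma connected_on_node_component:
  assumes "x \<in> B"
  shows "connected_on E (node_component E B x)"
proof (rule connected_onI)
  let ?C = "node_component E B x"
  show "x \<in> ?C" by (simp add: node_component_def)
  fix y assume "y \<in> ?C"
  then have "(\<lambda>a b. E a b \<and> a \<in> B \<and> b \<in> B)\<^sup>*\<^sup>* x y" by (simp add: node_component_def)
  then show "(\<lambda>a b. E a b \<and> a \<in> ?C \<and> b \<in> ?C)\<^sup>*\<^sup>* x y"
  proof induction
    case (step y z)
    then have "y \<in> ?C" by (simp add: node_component_def)
    moreover have "z \<in> ?C"
      unfolding node_component_def
      using rtranclp.rtrancl_into_rtrancl[OF step(1,2)] by simp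
    ultimately show ?case using rtranclp.rtrancl_into_rtrancl[OF step(3)] step(2) by simp
  qed simp
qed

lemma connected_on_subset_component:
  assumes "connected_on E S" "S \<subseteq> B" "y \<in> S" "y \<in> node_component E B x"
  shows "S \<subseteq> node_component E B x"
proof
  fix z assume "z \<in> S"
  then have "(\<lambda>a b. E a b \<and> a \<in> S \<and> b \<in> S)\<^sup>*\<^sup>* y z"
    using assms by (auto simp: connected_on_def)
  then have "(\<lambda>a b. E a b \<and> a \<in> B \<and> b \<in> B)\<^sup>*\<^sup>* y z"
    using assms(2) by (rule connected_on_mono_rtranclp)
  with assms(4) show "z \<in> node_component E B x"
    by (auto simp: node_component_def)
qed

lemma tube_part: "t \<in> parts E B \<Longrightarrow> tube E t"
  by (auto simp: parts_def tube_def connected_on_node_component split: if_splits)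

lemma part_subset: "t \<in> parts E B \<Longrightarrow> t \<subseteq> B"
  using node_component_subset by (auto simp: parts_def split: if_splits)

lemma Union_parts: "\<Union>(parts E B) = B"
proof
  show "\<Union>(parts E B) \<subseteq> B" using part_subset by blast
  show "B \<subseteq> \<Union>(parts E B)"
    by (auto simp: parts_def node_component_def)
qed

lemma tube_subset_part:
  assumes "t \<in> parts E B" "tube E u" "u \<subseteq> B" "u \<inter> t \<noteq> {}"
  shows "u \<subseteq> t"
proof (cases "B = UNIV")
  case True
  then show ?thesis using assms by (simp add: parts_def)
next
  case False
  then have "connected_on E u" using assms by (auto simp: tube_def)
  moreover obtain x where "t = node_component E B x"
    using assms(1) False by (auto simp: parts_def)
  ultimately show ?thesis
    using connected_on_subset_component[of u B _ x] assms(3,4) by blast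
qed

lemma parts_eqI:
  assumes "t \<in> parts E B" "t' \<in> parts E B" "t \<inter> t' \<noteq> {}"
  shows "t = t'"
  using tube_subset_part[OF assms(1) tube_part[OF assms(2)] part_subset[OF assms(2)]]
    tube_subset_part[OF assms(2) tube_part[OF assms(1)] part_subset[OF assms(1)]] assms(3)
  by blast

text \<open>The third hypothesis excludes components of a disconnected graph: they are closed under
  edges, yet are not parts of the full set.\<close>

lemma partI:
  assumes "tube E t" "t \<subseteq> B" "B = UNIV \<Longrightarrow> t = UNIV"
    and "\<And>j k. j \<in> t \<Longrightarrow> k \<in> B \<Longrightarrow> E j k \<Longrightarrow> k \<in> t"
  shows "t \<in> parts E B"
proof -
  obtain x where x: "x \<in> t" using assms(1) tube_nonempty by blast
  then obtain t' where t': "t' \<in> parts E B" "x \<in> t'"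
    using Union_parts assms(2) by blast
  have "t \<subseteq> t'" using tube_subset_part[OF t'(1) assms(1,2)] x t'(2) by blast
  moreover have "t' \<subseteq> t"
  proof (cases "t' = UNIV")
    case True
    then show ?thesis using part_subset[OF t'(1)] assms(3) by auto
  next
    case False
    then have "connected_on E t'" using tube_part[OF t'(1)] by (simp add: tube_def)
    then show ?thesis
      using t'(2) x
      by (rule connected_on_subset_closed) (use assms(4) part_subset[OF t'(1)] in blast)
  qed
  ultimately show ?thesis using t'(1) by simp
qed

text \<open>Used to raise the level of a superlevel set to the minimum on a given part without
  losing that part.\<close>

lemma part_of_subset:
  assumes "t \<in> parts E B" "t \<subseteq> B'" "B' \<subseteq> B"
  shows "t \<in> parts E B'"
proof -
  obtain x where x: "x \<in> t" using tube_part[OF assms(1)] tube_nonempty by blast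
  then obtain t' where t': "t' \<in> parts E B'" "x \<in> t'"
    using Union_parts assms(2) by blast
  have "t' \<subseteq> t"
    using tube_subset_part[OF assms(1) tube_part[OF t'(1)]] part_subset[OF t'(1)] assms(3) x t'(2)
    by blast
  moreover have "t \<subseteq> t'"
    using tube_subset_part[OF t'(1) tube_part[OF assms(1)] assms(2)] x t'(2) by blast
  ultimately show ?thesis using t'(1) by simp
qed

end

section \<open>Tubings as laminar families, and smallest enclosing tubes\<close>

lemma tubing_laminar:
  assumes "tubing E T" "u \<in> T" "v \<in> T" "u \<inter> v \<noteq> {}"
  shows "u \<subseteq> v \<or> v \<subseteq> u"
proof (cases "u = v")
  case False
  then have "compatible E u v" using assms by (auto simp: tubing_def pairwise_def)
  then show ?thesis using assms(4) by (auto simp: compatible_def tubes_intersect_def)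
qed simp

lemma tubing_tube: "tubing E T \<Longrightarrow> u \<in> T \<Longrightarrow> tube E u"
  by (simp add: tubing_def)

lemma tubing_UNIV: "tubing E T \<Longrightarrow> UNIV \<in> T"
  by (simp add: tubing_def)

lemma tubing_subset:
  assumes "tubing E T" "S \<subseteq> T" "UNIV \<in> S"
  shows "tubing E S"
  using assms unfolding tubing_def by (blast intro: pairwise_subset)

text \<open>Disjoint tubes are both proper, hence connected, so an edge between them would make
  their union a tube and the two adjacent.\<close>

lemma tubing_no_edge:
  assumes "symp E" "tubing E T" "u \<in> T" "v \<in> T" "u \<inter> v = {}" "j \<in> u" "k \<in> v"
  shows "\<not> E j k"
proof
  assume "E j k"
  have "u \<noteq> UNIV" "v \<noteq> UNIV" using assms by auto
  then have "connected_on E u" "connected_on E v"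
    using tubing_tube[OF assms(2)] assms(3,4) by (auto simp: tube_def)
  with \<open>E j k\<close> assms have "tube E (u \<union> v)"
    by (auto simp: tube_def dest: connected_on_Un_edge)
  moreover have "compatible E u v"
    using assms(2-6) unfolding tubing_def pairwise_def by blast
  ultimately show False using assms by (auto simp: compatible_def tubes_adjacent_def)
qed

lemma enclosing_upper: "S \<subseteq> enclosing T S"
  by (auto simp: enclosing_def)

lemma enclosing_least: "u \<in> T \<Longrightarrow> S \<subseteq> u \<Longrightarrow> enclosing T S \<subseteq> u"
  by (auto simp: enclosing_def)

lemma enclosing_self: "u \<in> T \<Longrightarrow> enclosing T u = u"
  by (simp add: subset_antisym enclosing_upper enclosing_least)

text \<open>A member of least cardinality containing \<open>S\<close> is comparable with every other
  such member, since both contain the nonempty \<open>S\<close>.\<close>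

lemma enclosing_mem:
  fixes S :: "'n::finite set"
  assumes "tubing E T" "S \<noteq> {}"
  shows "enclosing T S \<in> T"
proof -
  have "\<exists>w. (w \<in> T \<and> S \<subseteq> w) \<and> (\<forall>u. u \<in> T \<and> S \<subseteq> u \<longrightarrow> card w \<le> card u)"
    using assms(1) tubing_UNIV by (intro ex_has_least_nat[of _ UNIV]) auto
  then obtain w where w: "w \<in> T" "S \<subseteq> w" "\<And>u. u \<in> T \<Longrightarrow> S \<subseteq> u \<Longrightarrow> card w \<le> card u"
    by blast
  have "w \<subseteq> u" if "u \<in> T" "S \<subseteq> u" for u
  proof -
    have "u \<inter> w \<noteq> {}" using w that assms(2) by blast
    then have "u \<subseteq> w \<or> w \<subseteq> u" using tubing_laminar[OF assms(1)] w that by blast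
    then show ?thesis using w(3)[OF that] by (metis card_seteq finite)
  qed
  then have "enclosing T S = w" using w unfolding enclosing_def by blast
  then show ?thesis using w by simp
qed

lemma smallest_tube_eq:
  fixes U :: "'n::finite marked"
  assumes "tubing E (dom U)"
  shows "smallest_tube U i = enclosing (dom U) {i}"
  unfolding smallest_tube_def
proof (rule Least_equality)
  show "enclosing (dom U) {i} \<in> dom U \<and> i \<in> enclosing (dom U) {i}"
    using enclosing_mem[OF assms, of "{i}"] enclosing_upper[of "{i}" "dom U"] by auto
  show "\<And>y. y \<in> dom U \<and> i \<in> y \<Longrightarrow> enclosing (dom U) {i} \<subseteq> y"
    by (simp add: enclosing_least)
qed

lemma ex_maximal_member:
  fixes x :: "'n::finite"
  assumes "u \<in> F" "x \<in> u"
  obtains w where "w \<in> F" "u \<subseteq> w" "\<And>v. v \<in> F \<Longrightarrow> w \<subseteq> v \<Longrightarrow> v = w"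
proof -
  have "finite {v \<in> F. u \<subseteq> v}" "{v \<in> F. u \<subseteq> v} \<noteq> {}" using assms by auto
  then have "\<exists>w\<in>{v \<in> F. u \<subseteq> v}. \<forall>v\<in>{v \<in> F. u \<subseteq> v}. w \<subseteq> v \<longrightarrow> w = v"
    by (rule finite_has_maximal)
  then obtain w where "w \<in> F" "u \<subseteq> w" "\<forall>v\<in>{v \<in> F. u \<subseteq> v}. w \<subseteq> v \<longrightarrow> w = v"
    by blast
  then show ?thesis by (intro that) blast+
qed

text \<open>A maximal tube of \<open>F\<close> that meets \<open>w\<close> cannot be left along an
  edge inside \<open>w\<close>: the tube of \<open>F\<close> holding the next node is not disjoint
  from it, so it is comparable and by maximality contained.\<close>

lemma connected_subset_tube:
  fixes w :: "'n::finite set"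
  assumes "symp E" "tubing E T" "F \<subseteq> T" "connected_on E w" "w \<subseteq> \<Union>F"
  obtains u where "u \<in> F" "w \<subseteq> u"
proof -
  obtain x u0 where x: "x \<in> w" "u0 \<in> F" "x \<in> u0"
    using assms(4,5) by (fastforce simp: connected_on_def)
  obtain u where u: "u \<in> F" "u0 \<subseteq> u" "\<And>v. v \<in> F \<Longrightarrow> u \<subseteq> v \<Longrightarrow> v = u"
    using ex_maximal_member[OF x(2,3)] by metis
  have "w \<subseteq> u"
    using assms(4) x(1)
  proof (rule connected_on_subset_closed)
    show "x \<in> u" using x u by auto
    fix j k assume jk: "j \<in> u" "k \<in> w" "E j k"
    obtain v where v: "v \<in> F" "k \<in> v" using jk assms(5) by blast
    then have "u \<inter> v \<noteq> {}" using tubing_no_edge[OF assms(1,2)] jk u(1) assms(3) by blast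
    then have "u \<subseteq> v \<or> v \<subseteq> u" using tubing_laminar[OF assms(2)] u(1) v(1) assms(3) by blast
    then show "k \<in> u" using u(3) v by blast
  qed
  then show ?thesis using that u by blast
qed

text \<open>For the universal tube of a disconnected graph, this is exactly what forbidding all
  connected components in a tubing achieves.\<close>

lemma tube_own_node:
  fixes t :: "'n::finite set"
  assumes "symp E" "tubing E T" "t \<in> T"
  obtains i where "i \<in> t" "enclosing T {i} = t"
proof -
  let ?F = "{u \<in> T. u \<subset> t}"
  have "\<not> t \<subseteq> \<Union>?F"
  proof
    assume cover: "t \<subseteq> \<Union>?F"
    show False
    proof (cases "connected_on E t")
      case True
      then show False using connected_subset_tube[OF assms(1,2), of ?F t] cover by blast
    next
      case False
      then have t: "t = UNIV" using tubing_tube[OF assms(2,3)] by (simp add: tube_def)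
      \<comment> \<open>A component lies in one of the covering proper tubes; that tube is connected
        and hence equals the component. So a cover would put all components into
        \<open>T\<close>.\<close>
      have "K \<in> T" if "K \<in> connected_components E" for K
      proof -
        from that obtain x where K: "K = {y. E\<^sup>*\<^sup>* x y}" by (auto simp: connected_components_def)
        then have K': "K = node_component E UNIV x" by (simp add: node_component_def)
        then have conK: "connected_on E K" using connected_on_node_component[OF assms(1)] by simp
        obtain u where u: "u \<in> ?F" "K \<subseteq> u"
          using connected_subset_tube[OF assms(1,2) _ conK, of ?F] cover t by blast
        then have "connected_on E u" using tubing_tube[OF assms(2), of u] t by (auto simp: tube_def)
        then have "u \<subseteq> K"
          using connected_on_subset_component[OF assms(1) _ subset_UNIV, of u x x] u(2) K K' by auto
        then show ?thesis using u by auto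
      qed
      then show False using assms(2) False t by (auto simp: tubing_def)
    qed
  qed
  then obtain i where i: "i \<in> t" "\<And>u. u \<in> T \<Longrightarrow> u \<subset> t \<Longrightarrow> i \<notin> u" by blast
  have "enclosing T {i} \<in> T" using enclosing_mem[OF assms(2)] by auto
  moreover have "i \<in> enclosing T {i}" using enclosing_upper by fastforce
  moreover have "enclosing T {i} \<subseteq> t" using assms(3) i(1) by (intro enclosing_least) auto
  ultimately have "enclosing T {i} = t" using i(2) by blast
  then show ?thesis using that i by blast
qed

section \<open>Level markings\<close>

definition level_tubes :: "('n::finite \<Rightarrow> 'n \<Rightarrow> bool) \<Rightarrow> ('n \<Rightarrow> real) \<Rightarrow> 'n set set" where
  "level_tubes E a = (\<Union>s. parts E {i. s \<le> a i})"

definition sign_marking :: "real \<Rightarrow> marking" where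
  "sign_marking m = (if m > 0 then Thin else if m = 0 then Broken else Thick)"

definition level_marking :: "('n::finite \<Rightarrow> 'n \<Rightarrow> bool) \<Rightarrow> ('n \<Rightarrow> real) \<Rightarrow> 'n marked" where
  "level_marking E a =
     (\<lambda>t. if t \<in> level_tubes E a then Some (sign_marking (Min (a ` t))) else None)"

text \<open>Chosen so that the sign encodes the mark and the value decreases strictly from a tube to
  any larger one. The offset \<open>CARD('n) + 1\<close> keeps thin heights positive; the constant 0
  suffices for broken tubes because they are never nested.\<close>

definition tube_height :: "'n::finite marked \<Rightarrow> 'n set \<Rightarrow> real" where
  "tube_height U t =
     (case U t of Some Thin \<Rightarrow> real CARD('n) + 1 - real (card t)
      | Some Thick \<Rightarrow> - real (card t) | _ \<Rightarrow> 0)"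

lemma dom_level_marking [simp]: "dom (level_marking E a) = level_tubes E a"
  by (auto simp: level_marking_def split: if_splits)

lemma Min_level_in:
  fixes t :: "'n::finite set"
  assumes "tube E t"
  obtains i where "i \<in> t" "a i = Min (a ` t)"
proof -
  have "Min (a ` t) \<in> a ` t" using tube_nonempty[OF assms] by (intro Min_in) auto
  then show ?thesis using that by auto
qed

context
  fixes E :: "'n::finite \<Rightarrow> 'n \<Rightarrow> bool"
  assumes symE: "symp E"
begin

lemma level_tube_tube: "t \<in> level_tubes E a \<Longrightarrow> tube E t"
  by (auto simp: level_tubes_def tube_part[OF symE])

text \<open>Every level tube can be cut out at a canonical level, its own minimum.\<close>

lemma level_tube_part:
  assumes "t \<in> level_tubes E a"
  shows "t \<in> parts E {i. Min (a ` t) \<le> a i}"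
proof -
  obtain s where s: "t \<in> parts E {i. s \<le> a i}"
    using assms by (auto simp: level_tubes_def)
  obtain i where i: "i \<in> t" "a i = Min (a ` t)"
    using Min_level_in[OF level_tube_tube[OF assms]] .
  then have "s \<le> Min (a ` t)" using part_subset[OF symE s] by fastforce
  then show ?thesis by (intro part_of_subset[OF symE s]) auto
qed

lemma tube_subset_level_tube:
  assumes "t \<in> level_tubes E a" "tube E u" "u \<inter> t \<noteq> {}" "\<And>i. i \<in> u \<Longrightarrow> Min (a ` t) \<le> a i"
  shows "u \<subseteq> t"
  using tube_subset_part[OF symE level_tube_part[OF assms(1)] assms(2)] assms(3,4) by blast

text \<open>Otherwise \<open>v\<close> would lie in the superlevel set of which \<open>u\<close> is
  a part, and meeting \<open>u\<close> it would be contained in \<open>u\<close>.\<close>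

lemma Min_level_strict:
  assumes "u \<in> level_tubes E a" "tube E v" "u \<subset> v"
  shows "Min (a ` v) < Min (a ` u)"
proof (rule ccontr)
  assume "\<not> ?thesis"
  then have "Min (a ` u) \<le> a i" if "i \<in> v" for i
    using that order_trans[of "Min (a ` u)" "Min (a ` v)" "a i"] by simp
  then have "v \<subseteq> u"
    using assms tube_nonempty[OF level_tube_tube[OF assms(1)]]
    by (intro tube_subset_level_tube) blast+
  then show False using assms(3) by blast
qed

text \<open>Of two level tubes take the one with the smaller minimum: it is a part of a superlevel
  set containing both, so it swallows the other as soon as they meet or their union is a
  tube.\<close>

lemma tubing_level_tubes: "tubing E (level_tubes E a)"
  unfolding tubing_def
proof (intro conjI impI ballI)
  show "\<And>u. u \<in> level_tubes E a \<Longrightarrow> tube E u" by (rule level_tube_tube)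
  have main: "compatible E u v \<and> compatible E v u"
    if uv: "u \<in> level_tubes E a" "v \<in> level_tubes E a" "u \<noteq> v" "Min (a ` u) \<le> Min (a ` v)" for u v
  proof -
    have above: "Min (a ` u) \<le> a i" if "i \<in> u \<union> v" for i
      using that order_trans[OF uv(4), of "a i"] by auto
    have "v \<subseteq> u" if "u \<inter> v \<noteq> {} \<or> tube E (u \<union> v)"
      using that
    proof
      assume "u \<inter> v \<noteq> {}"
      then show ?thesis
        using above uv by (intro tube_subset_level_tube level_tube_tube) auto
    next
      assume "tube E (u \<union> v)"
      moreover have "u \<noteq> {}" using level_tube_tube[OF uv(1)] tube_nonempty by blast
      ultimately have "u \<union> v \<subseteq> u"
        using above uv by (intro tube_subset_level_tube) auto
      then show ?thesis by blast
    qed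
    moreover have "v \<noteq> {}" using level_tube_tube[OF uv(2)] tube_nonempty by blast
    ultimately show ?thesis
      using uv(3) unfolding compatible_def tubes_intersect_def tubes_adjacent_def
      by (auto simp: Un_commute Int_commute)
  qed
  show "pairwise (compatible E) (level_tubes E a)"
  proof (rule pairwiseI)
    fix u v assume "u \<in> level_tubes E a" "v \<in> level_tubes E a" "u \<noteq> v"
    then show "compatible E u v"
      using main[of u v] main[of v u] linear[of "Min (a ` u)" "Min (a ` v)"] by blast
  qed
  have "{i. Min (range a) \<le> a i} = UNIV" by auto
  then show "UNIV \<in> level_tubes E a"
    unfolding level_tubes_def parts_def by (intro UN_I[of "Min (range a)"]) simp_all
  assume disc: "\<not> connected_on E UNIV"
  show "\<not> connected_components E \<subseteq> level_tubes E a"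
  proof
    assume sub: "connected_components E \<subseteq> level_tubes E a"
    \<comment> \<open>The component of a global minimiser cannot be a level tube: the superlevel set
      at its minimum is everything, whose only part is the universal tube.\<close>
    obtain i where i: "a i = Min (range a)" using Min_in[of "range a"] by fastforce
    let ?K = "{y. E\<^sup>*\<^sup>* i y}"
    have "?K \<in> level_tubes E a" using sub by (auto simp: connected_components_def)
    moreover have "tube E UNIV" by (simp add: tube_def)
    moreover have "Min (a ` ?K) \<le> a j" for j
    proof -
      have "Min (a ` ?K) \<le> a i" by (intro Min_le) auto
      also have "\<dots> \<le> a j" using i by simp
      finally show ?thesis .
    qed
    ultimately have "UNIV \<subseteq> ?K" by (intro tube_subset_level_tube) auto
    then have "connected_on E UNIV"
      by (intro connected_onI[OF symE, of i]) auto
    with disc show False by simp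
  qed
qed

text \<open>Minima grow strictly inwards, so inside a tube with minimum at least 0 they are
  positive.\<close>

lemma marked_tubing_level_marking: "marked_tubing E (level_marking E a)"
  unfolding marked_tubing_def
proof (intro conjI ballI impI)
  show "tubing E (dom (level_marking E a))" by (simp add: tubing_level_tubes)
  fix u v
  assume "u \<in> dom (level_marking E a)" "v \<in> dom (level_marking E a)"
    "u \<subset> v \<and> level_marking E a v \<noteq> Some Thick"
  moreover from this have "Min (a ` v) < Min (a ` u)"
    using Min_level_strict[of u a v] level_tube_tube[of v a] by simp
  ultimately show "level_marking E a u = Some Thin"
    by (auto simp: level_marking_def sign_marking_def split: if_splits)
qed

text \<open>The part around \<open>t\<close> of the superlevel set at the minimum of
  \<open>t\<close> is a level tube, so the smallest level tube around \<open>t\<close> reaches no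
  lower. This lets the level marking be read off from any tube.\<close>

lemma Min_enclosing_level_tubes:
  assumes "tube E t"
  shows "Min (a ` enclosing (level_tubes E a) t) = Min (a ` t)"
proof (rule order.antisym)
  let ?w = "enclosing (level_tubes E a) t"
  have t: "t \<noteq> {}" "t \<subseteq> ?w" by (rule tube_nonempty[OF assms], rule enclosing_upper)
  then show "Min (a ` ?w) \<le> Min (a ` t)" by (intro Min_antimono) auto
  obtain x where "x \<in> t" using t(1) by blast
  then have "x \<in> \<Union>(parts E {j. Min (a ` t) \<le> a j})" by (simp add: Union_parts[OF symE])
  then obtain p where p: "p \<in> parts E {j. Min (a ` t) \<le> a j}" "p \<inter> t \<noteq> {}"
    using \<open>x \<in> t\<close> by blast
  have "t \<subseteq> p" using p(2) by (intro tube_subset_part[OF symE p(1) assms]) auto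
  moreover have "p \<in> level_tubes E a" using p by (auto simp: level_tubes_def)
  ultimately have "?w \<subseteq> p" by (intro enclosing_least)
  then show "Min (a ` t) \<le> Min (a ` ?w)"
    using part_subset[OF symE p(1)] t by (intro Min.boundedI) auto
qed

lemma tube_height_strict:
  assumes "marked_tubing E U" "u \<in> dom U" "v \<in> dom U" "u \<subset> v"
  shows "tube_height U v < tube_height U u"
proof -
  have card: "card u < card v" using assms(4) by (simp add: psubset_card_mono)
  have le: "card w \<le> CARD('n)" for w :: "'n set" by (simp add: card_mono)
  have pos: "card v > 0" using card by simp
  have "U v \<noteq> Some Thick \<Longrightarrow> U u = Some Thin"
    using assms by (auto simp: marked_tubing_def)
  moreover obtain x y where "U u = Some x" "U v = Some y" using assms by auto
  ultimately show ?thesis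
    using card le[of u] le[of v] pos unfolding tube_height_def
    by (cases x; cases y) auto
qed

lemma sign_marking_tube_height:
  assumes "U t = Some m" "tube E t"
  shows "sign_marking (tube_height U t) = m"
proof -
  have "card t \<le> CARD('n)" by (simp add: card_mono)
  moreover have "card t > 0" using tube_nonempty[OF assms(2)] by (simp add: card_gt_0_iff)
  ultimately show ?thesis
    using assms(1) by (cases m) (auto simp: tube_height_def sign_marking_def)
qed

text \<open>Each node receives the height of its smallest tube. Heights fall outwards, so the
  minimum on a tube is attained at a node whose smallest tube it is, and equals its height.\<close>

lemma marked_tubing_eq_level_marking:
  assumes U: "marked_tubing E U"
  obtains a where "level_marking E a = U"
proof
  define a where "a i = tube_height U (enclosing (dom U) {i})" for i
  have tub: "tubing E (dom U)" using U by (simp add: marked_tubing_def)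
  have encl: "enclosing (dom U) {i} \<in> dom U" "i \<in> enclosing (dom U) {i}" for i
    using enclosing_mem[OF tub, of "{i}"] enclosing_upper[of "{i}" "dom U"] by auto
  have mono: "tube_height U v \<le> tube_height U u" if "u \<in> dom U" "v \<in> dom U" "u \<subseteq> v" for u v
    using tube_height_strict[OF U, of u v] that by (cases "u = v") (auto simp: psubset_eq)
  have ge: "tube_height U t \<le> a i" if "t \<in> dom U" "i \<in> t" for t i
    unfolding a_def using that encl by (intro mono enclosing_least) auto
  have Min_eq: "Min (a ` t) = tube_height U t" if t: "t \<in> dom U" for t
  proof -
    obtain i where "i \<in> t" "enclosing (dom U) {i} = t" using tube_own_node[OF symE tub t] .
    then have "a i = tube_height U t" by (simp add: a_def)
    then show ?thesis using \<open>i \<in> t\<close> ge[OF t]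
      by (intro Min_eqI) (auto simp: image_iff intro: bexI[of _ i])
  qed
  have part: "t \<in> parts E {i. tube_height U t \<le> a i}" if t: "t \<in> dom U" for t
  proof (rule partI[OF symE])
    show "tube E t" using tubing_tube[OF tub t] .
    show "t \<subseteq> {i. tube_height U t \<le> a i}" using ge[OF t] by blast
    show "t = UNIV" if "{i. tube_height U t \<le> a i} = UNIV"
    proof (rule ccontr)
      assume "t \<noteq> UNIV"
      then have lt: "tube_height U UNIV < tube_height U t"
        using tube_height_strict[OF U t tubing_UNIV[OF tub]] by blast
      obtain i where "enclosing (dom U) {i} = UNIV"
        using tube_own_node[OF symE tub tubing_UNIV[OF tub]] by blast
      then have "a i = tube_height U UNIV" by (simp add: a_def)
      moreover have "tube_height U t \<le> a i" using that by blast
      ultimately show False using lt by simp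
    qed
    fix j k assume jk: "j \<in> t" "k \<in> {i. tube_height U t \<le> a i}" "E j k"
    \<comment> \<open>The tube \<open>?u\<close> is at least as high as \<open>t\<close>, so it does
      not strictly contain \<open>t\<close>; the edge excludes disjointness, and laminarity leaves
      \<open>?u \<subseteq> t\<close>.\<close>
    let ?u = "enclosing (dom U) {k}"
    have u: "?u \<in> dom U" "k \<in> ?u" by (rule encl)+
    have "\<not> t \<subset> ?u" using tube_height_strict[OF U t u(1)] jk(2) by (auto simp: a_def)
    moreover have "t \<inter> ?u \<noteq> {}" using tubing_no_edge[OF symE tub t u(1)] jk u(2) by blast
    ultimately have "?u \<subseteq> t" using tubing_laminar[OF tub t u(1)] by blast
    then show "k \<in> t" using u(2) by blast
  qed
  have "level_tubes E a = dom U"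
  proof
    show "dom U \<subseteq> level_tubes E a" using part by (auto simp: level_tubes_def)
    show "level_tubes E a \<subseteq> dom U"
    proof
      \<comment> \<open>A level tube and the smallest tube of its minimising node are parts of one
        superlevel set and share that node.\<close>
      fix t assume t: "t \<in> level_tubes E a"
      obtain i where i: "i \<in> t" "a i = Min (a ` t)"
        using Min_level_in[OF level_tube_tube[OF t]] .
      have "t \<in> parts E {j. a i \<le> a j}" using level_tube_part[OF t] i(2) by simp
      moreover have "enclosing (dom U) {i} \<in> parts E {j. a i \<le> a j}"
        using part[OF encl(1)[of i]] by (simp add: a_def)
      ultimately have "t = enclosing (dom U) {i}"
        using encl(2)[of i] i(1) by (intro parts_eqI[OF symE]) auto
      then show "t \<in> dom U" using encl(1) by simp
    qed
  qed
  moreover have "sign_marking (Min (a ` t)) = m" if "U t = Some m" for t m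
    using sign_marking_tube_height[of U t m] Min_eq[of t] tubing_tube[OF tub, of t] that
    by (simp add: domI)
  ultimately show "level_marking E a = U"
    by (intro ext) (auto simp: level_marking_def)
qed

end

section \<open>Refinement of marked tubings\<close>

text \<open>A description of the order without moves: every tube of \<open>U\<close> inherits the
  mark of the smallest tube of \<open>U'\<close> around it, except that a broken mark leaves the
  choice open.\<close>

definition marking_refines :: "'n marked \<Rightarrow> 'n marked \<Rightarrow> bool" where
  "marking_refines U U' \<longleftrightarrow> dom U' \<subseteq> dom U \<and>
     (\<forall>t\<in>dom U. U' (enclosing (dom U') t) \<noteq> Some Broken \<longrightarrow> U t = U' (enclosing (dom U') t))"

lemma refines_dom: "marking_refines U U' \<Longrightarrow> dom U' \<subseteq> dom U"
  by (simp add: marking_refines_def)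

lemma refinesD:
  assumes "marking_refines U U'" "t \<in> dom U" "U' (enclosing (dom U') t) \<noteq> Some Broken"
  shows "U t = U' (enclosing (dom U') t)"
  using assms unfolding marking_refines_def by blast

lemma refinesD_self:
  assumes "marking_refines U U'" "t \<in> dom U'" "U' t \<noteq> Some Broken"
  shows "U t = U' t"
  using refinesD[OF assms(1), of t] refines_dom[OF assms(1)] assms(2,3)
  by (auto simp: enclosing_self)

text \<open>The point is that smallest enclosing tubes compose: enclosing \<open>t\<close> first in
  \<open>dom U'\<close> and then in \<open>dom U''\<close> gives the same as enclosing it in
  \<open>dom U''\<close>.\<close>

lemma refines_trans:
  fixes U :: "'n::finite marked"
  assumes U: "tubing E (dom U)" and U': "tubing E (dom U')" and U'': "tubing E (dom U'')"
    and "marking_refines U U'" "marking_refines U' U''"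
  shows "marking_refines U U''"
  unfolding marking_refines_def
proof (intro conjI ballI impI)
  show "dom U'' \<subseteq> dom U" using refines_dom[OF assms(4)] refines_dom[OF assms(5)] by (rule subset_trans[rotated])
  fix t assume t: "t \<in> dom U" and nb: "U'' (enclosing (dom U'') t) \<noteq> Some Broken"
  let ?w = "enclosing (dom U'') t" and ?v = "enclosing (dom U') t"
  have ne: "t \<noteq> {}" using tubing_tube[OF U t] by (rule tube_nonempty)
  have v: "?v \<in> dom U'" "t \<subseteq> ?v" by (rule enclosing_mem[OF U' ne], rule enclosing_upper)
  have w: "?w \<in> dom U''" "t \<subseteq> ?w" by (rule enclosing_mem[OF U'' ne], rule enclosing_upper)
  have "?w \<in> dom U'" using w(1) refines_dom[OF assms(5)] by (rule subsetD[rotated])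
  then have "?v \<subseteq> ?w" using w(2) by (rule enclosing_least)
  have "enclosing (dom U'') ?v = ?w"
  proof (rule subset_antisym)
    show "enclosing (dom U'') ?v \<subseteq> ?w" using enclosing_least[OF w(1) \<open>?v \<subseteq> ?w\<close>] .
    show "?w \<subseteq> enclosing (dom U'') ?v"
      using v ne enclosing_upper[of ?v "dom U''"]
      by (intro enclosing_least enclosing_mem[OF U'']) auto
  qed
  then have "U' ?v = U'' ?w" using refinesD[OF assms(5) v(1)] nb by simp
  moreover from this have "U t = U' ?v" using refinesD[OF assms(4) t] nb by simp
  ultimately show "U t = U'' ?w" by simp
qed

lemma refines_antisym:
  assumes "marking_refines U U'" "marking_refines U' U"
  shows "U = U'"
proof
  fix t
  have dom: "dom U = dom U'" using assms by (intro subset_antisym refines_dom)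
  show "U t = U' t"
  proof (cases "t \<in> dom U")
    case True
    then have "U' t \<noteq> Some Broken \<Longrightarrow> U t = U' t" "U t \<noteq> Some Broken \<Longrightarrow> U' t = U t"
      using refinesD_self[OF assms(1), of t] refinesD_self[OF assms(2), of t] dom by blast+
    then show ?thesis by metis
  next
    case False
    then have "t \<notin> dom U'" using dom by simp
    with False show ?thesis by (simp add: domIff)
  qed
qed

text \<open>In the arrangement of the hyperplanes where two coordinates agree or one vanishes,
  \<open>a\<close> lies in the closure of the cell of \<open>a'\<close>.\<close>

definition order_refines :: "('n \<Rightarrow> real) \<Rightarrow> ('n \<Rightarrow> real) \<Rightarrow> bool" where
  "order_refines a' a \<longleftrightarrow> (\<forall>i j. a i < a j \<longrightarrow> a' i < a' j) \<and>
     (\<forall>i. a i < 0 \<longrightarrow> a' i < 0) \<and> (\<forall>i. a i > 0 \<longrightarrow> a' i > 0)"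

lemma ex_perturbation:
  fixes a r :: "'n::finite \<Rightarrow> real"
  obtains d where "d > 0" "order_refines (\<lambda>i. a i + d * r i) a"
proof -
  have lim: "((\<lambda>d. x + d * y) \<longlongrightarrow> x) (at_right 0)" for x y :: real
    by (rule tendsto_eq_intros refl tendsto_ident_at | simp)+
  have less: "\<forall>\<^sub>F d in at_right 0. x + d * y < x' + d * y'" if "x < x'" for x x' y y' :: real
  proof -
    have "((\<lambda>d. (x' + d * y') - (x + d * y)) \<longlongrightarrow> x' - x) (at_right 0)"
      by (intro tendsto_diff lim)
    then have "\<forall>\<^sub>F d in at_right 0. 0 < (x' + d * y') - (x + d * y)"
      using that by (intro order_tendstoD(1)) auto
    then show ?thesis by eventually_elim simp
  qed
  have "\<forall>\<^sub>F d in at_right 0. a i < a j \<longrightarrow> a i + d * r i < a j + d * r j" for i j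
    using less by (cases "a i < a j") simp_all
  moreover have "\<forall>\<^sub>F d in at_right 0. a i < 0 \<longrightarrow> a i + d * r i < 0" for i
    using less[of "a i" 0 "r i" 0] by (cases "a i < 0") simp_all
  moreover have "\<forall>\<^sub>F d in at_right 0. a i > 0 \<longrightarrow> a i + d * r i > 0" for i
    using less[of 0 "a i" 0 "r i"] by (cases "a i > 0") simp_all
  ultimately have "\<forall>\<^sub>F d in at_right 0. order_refines (\<lambda>i. a i + d * r i) a"
    unfolding order_refines_def by (intro eventually_conj eventually_all_finite)
  moreover have "\<forall>\<^sub>F d in at_right (0::real). d > 0" by (rule eventually_at_right_less)
  ultimately have "\<forall>\<^sub>F d in at_right 0. d > 0 \<and> order_refines (\<lambda>i. a i + d * r i) a"
    by (rule eventually_conj[rotated])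
  then have "\<exists>d. d > 0 \<and> order_refines (\<lambda>i. a i + d * r i) a"
    by (rule eventually_happens'[rotated]) simp
  then show ?thesis using that by blast
qed

text \<open>Perturbation directions: injective to break all ties, positive to control signs, and
  smallest at a prescribed node \<open>i\<close> so that ties are broken in its favour.\<close>

lemma ex_injective_pos:
  "\<exists>r :: 'n::finite \<Rightarrow> real. inj r \<and> (\<forall>j. r j > 0) \<and> (\<forall>j. r i \<le> r j)"
proof -
  obtain f :: "'n \<Rightarrow> nat" where f: "inj f"
    using finite_imp_inj_to_nat_seg[of "UNIV :: 'n set"] by auto
  define r where "r j = (if j = i then 1 else real (f j) + 2)" for j
  have "inj r" using f by (auto simp: inj_def r_def)
  moreover have "\<forall>j. r j > 0" "\<forall>j. r i \<le> r j" by (auto simp: r_def)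
  ultimately show ?thesis by blast
qed

context
  fixes E :: "'n::finite \<Rightarrow> 'n \<Rightarrow> bool"
  assumes symE: "symp E"
begin

lemma tube_singleton: "tube E {i}"
  by (simp add: tube_def connected_on_def)

text \<open>A superlevel set of \<open>a\<close> is also one of \<open>a'\<close>, at the least
  value that \<open>a'\<close> takes on it, so level tubes survive. Nonzero signs of minima survive
  too, and a zero minimum means broken and imposes nothing.\<close>

lemma order_refines_level_marking:
  assumes "order_refines a' a"
  shows "marking_refines (level_marking E a') (level_marking E a)"
  unfolding marking_refines_def dom_level_marking
proof (intro conjI ballI impI subsetI)
  fix t assume t: "t \<in> level_tubes E a"
  let ?B = "{i. Min (a ` t) \<le> a i}"
  have "t \<noteq> {}" using level_tube_tube[OF symE t] tube_nonempty by blast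
  then obtain i where "i \<in> t" by blast
  then have "i \<in> ?B" by simp
  then have "?B \<noteq> {}" by blast
  then have "Min (a' ` ?B) \<in> a' ` ?B" by (intro Min_in) auto
  then obtain j where j: "j \<in> ?B" "Min (a' ` ?B) = a' j" by blast
  have "a j \<le> a i" if "a' j \<le> a' i" for i
    using assms that by (force simp: order_refines_def not_less[symmetric])
  then have "{i. a' j \<le> a' i} \<subseteq> ?B" using j(1) by fastforce
  moreover have "a' j \<le> a' i" if "i \<in> ?B" for i
    unfolding j(2)[symmetric] using that by (intro Min_le) auto
  ultimately have "?B = {i. a' j \<le> a' i}" by blast
  with level_tube_part[OF symE t] show "t \<in> level_tubes E a'" by (auto simp: level_tubes_def)
next
  fix t assume t: "t \<in> level_tubes E a'"
    and nb: "level_marking E a (enclosing (level_tubes E a) t) \<noteq> Some Broken"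
  let ?w = "enclosing (level_tubes E a) t"
  have tube: "tube E t" using level_tube_tube[OF symE t] .
  have "?w \<in> level_tubes E a"
    using enclosing_mem[OF tubing_level_tubes[OF symE]] tube_nonempty[OF tube] .
  then have w: "level_marking E a ?w = Some (sign_marking (Min (a ` t)))"
    using Min_enclosing_level_tubes[OF symE tube] by (simp add: level_marking_def)
  then have "Min (a ` t) \<noteq> 0" using nb by (auto simp: sign_marking_def)
  moreover have "Min (a' ` t) > 0" if "Min (a ` t) > 0"
    using that assms tube_nonempty[OF tube] by (simp add: order_refines_def)
  moreover have "Min (a' ` t) < 0" if "Min (a ` t) < 0"
    using that assms tube_nonempty[OF tube] by (auto simp: order_refines_def Min_less_iff)
  ultimately have "sign_marking (Min (a' ` t)) = sign_marking (Min (a ` t))"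
    by (auto simp: sign_marking_def not_less)
  then show "level_marking E a' t = level_marking E a ?w"
    using t w by (simp add: level_marking_def)
qed

section \<open>Maximal marked tubings from generic level functions\<close>

lemma enclosing_surj:
  assumes "tubing E T"
  shows "(\<lambda>i. enclosing T {i}) ` UNIV = T"
proof
  show "range (\<lambda>i. enclosing T {i}) \<subseteq> T" using enclosing_mem[OF assms] by auto
  show "T \<subseteq> range (\<lambda>i. enclosing T {i})"
  proof
    fix t assume "t \<in> T"
    then obtain i where "enclosing T {i} = t" using tube_own_node[OF symE assms] by blast
    then show "t \<in> range (\<lambda>i. enclosing T {i})" by blast
  qed
qed

text \<open>The value at a node is the minimum on its smallest level tube, so distinct values give
  distinct tubes, and nonzero values exclude broken ones.\<close>

lemma level_marking_maximal:
  assumes "inj a" "\<And>i. a i \<noteq> 0"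
  shows "level_marking E a \<in> maximal_marked_tubings E"
proof -
  let ?T = "level_tubes E a"
  have Min: "Min (a ` enclosing ?T {i}) = a i" for i
    using Min_enclosing_level_tubes[OF symE tube_singleton, of a i] by simp
  have "inj (\<lambda>i. enclosing ?T {i})"
  proof (rule injI)
    fix i j assume "enclosing ?T {i} = enclosing ?T {j}"
    then have "a i = a j" using Min[of i] Min[of j] by simp
    then show "i = j" using assms(1) by (simp add: injD)
  qed
  then have "card ((\<lambda>i. enclosing ?T {i}) ` UNIV) = CARD('n)" by (rule card_image)
  then have "card ?T = CARD('n)" using enclosing_surj[OF tubing_level_tubes[OF symE]] by simp
  moreover have "Min (a ` t) \<noteq> 0" if "t \<in> ?T" for t
  proof -
    obtain i where "enclosing ?T {i} = t"
      using tube_own_node[OF symE tubing_level_tubes[OF symE] \<open>t \<in> ?T\<close>] by blast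
    then show ?thesis using Min[of i] assms(2)[of i] by simp
  qed
  then have "ran (level_marking E a) \<subseteq> {Thin, Thick}"
    by (auto simp: ran_def level_marking_def sign_marking_def split: if_splits)
  ultimately show ?thesis
    using marked_tubing_level_marking[OF symE, of a] by (simp add: maximal_marked_tubings_def)
qed

text \<open>Adding \<open>d * r\<close> with small \<open>d\<close> keeps the strict relations of
  \<open>a\<close>; injectivity of \<open>r\<close> breaks the ties and its signs decide the zeros,
  so \<open>r\<close> steers which maximal refinement results.\<close>

lemma ex_generic_perturbation:
  fixes a r :: "'n \<Rightarrow> real"
  assumes "inj r" "\<And>i. r i \<noteq> 0"
  obtains a' where "level_marking E a' \<in> maximal_marked_tubings E"
    "marking_refines (level_marking E a') (level_marking E a)"
    "\<And>i j. a i < a j \<Longrightarrow> a' i < a' j"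
    "\<And>i j. a i = a j \<Longrightarrow> r i \<le> r j \<Longrightarrow> a' i \<le> a' j"
    "\<And>i. a i \<ge> 0 \<Longrightarrow> r i > 0 \<Longrightarrow> a' i > 0"
    "\<And>i. a i \<le> 0 \<Longrightarrow> r i < 0 \<Longrightarrow> a' i < 0"
proof -
  obtain d where d: "d > 0" "order_refines (\<lambda>i. a i + d * r i) a" using ex_perturbation .
  define a' where "a' = (\<lambda>i. a i + d * r i)"
  have ref: "order_refines a' a" unfolding a'_def by (rule d(2))
  have "inj a'"
  proof (rule injI)
    fix i j assume eq: "a' i = a' j"
    have "\<not> a i < a j" "\<not> a j < a i" using ref eq unfolding order_refines_def by fastforce+
    then have "a i = a j" by simp
    then have "r i = r j" using eq d(1) by (simp add: a'_def)
    then show "i = j" using assms(1) by (simp add: injD)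
  qed
  moreover have "a' i \<noteq> 0" for i
  proof (cases "a i = 0")
    case True
    then show ?thesis using d(1) assms(2) by (simp add: a'_def)
  next
    case False
    then have "a i < 0 \<or> a i > 0" by auto
    then show ?thesis using ref unfolding order_refines_def by fastforce
  qed
  ultimately have "level_marking E a' \<in> maximal_marked_tubings E" by (rule level_marking_maximal)
  moreover have "marking_refines (level_marking E a') (level_marking E a)"
    using ref by (rule order_refines_level_marking)
  moreover have "a i < a j \<Longrightarrow> a' i < a' j" for i j using ref by (simp add: order_refines_def)
  moreover have "a i = a j \<Longrightarrow> r i \<le> r j \<Longrightarrow> a' i \<le> a' j" for i j
    using d(1) by (simp add: a'_def mult_left_mono)
  moreover have "a i \<ge> 0 \<Longrightarrow> r i > 0 \<Longrightarrow> a' i > 0" "a i \<le> 0 \<Longrightarrow> r i < 0 \<Longrightarrow> a' i < 0" for i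
    using d(1) by (simp_all add: a'_def add_nonneg_pos add_nonpos_neg mult_pos_neg)
  ultimately show ?thesis by (rule that)
qed

lemma ex_maximal_refinement:
  obtains M where "M \<in> maximal_marked_tubings E" "marking_refines M (level_marking E a)"
proof -
  obtain r :: "'n \<Rightarrow> real" where r: "inj r" "\<And>i. r i > 0"
    using ex_injective_pos[of undefined] by blast
  have rnz: "r i \<noteq> 0" for i using r(2)[of i] by simp
  show ?thesis
    by (rule ex_generic_perturbation[OF r(1) rnz, of a]) (erule (1) that)
qed

text \<open>For a suspected violation a suitably steered perturbation of \<open>U\<close> yields a
  maximal refinement that would expose it.\<close>

lemma refines_if_maximal_refines:
  assumes "marked_tubing E U" "marked_tubing E U'"
    and sub: "\<And>M. M \<in> maximal_marked_tubings E \<Longrightarrow> marking_refines M U \<Longrightarrow> marking_refines M U'"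
  shows "marking_refines U U'"
proof -
  obtain a where a: "level_marking E a = U"
    using marked_tubing_eq_level_marking[OF symE assms(1)] .
  then have dom: "dom U = level_tubes E a" using dom_level_marking[of E a] by simp
  have tub': "tubing E (dom U')" using assms(2) by (simp add: marked_tubing_def)
  show ?thesis
    unfolding marking_refines_def
  proof (intro conjI ballI impI subsetI)
    fix t assume "t \<in> dom U'"
    then have tube: "tube E t" using tubing_tube[OF tub'] by blast
    let ?w = "enclosing (level_tubes E a) t"
    have w: "?w \<in> level_tubes E a" "t \<subseteq> ?w"
      using enclosing_mem[OF tubing_level_tubes[OF symE] tube_nonempty[OF tube]] enclosing_upper .
    obtain i where i: "i \<in> t" "a i = Min (a ` t)" using Min_level_in[OF tube] .
    \<comment> \<open>With ties broken in favour of \<open>i\<close>, the node \<open>i\<close>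
      stays minimal on \<open>?w\<close>, so the level tube \<open>t\<close> of \<open>a'\<close>
      swallows \<open>?w\<close>; hence \<open>t = ?w\<close>.\<close>
    obtain r :: "'n \<Rightarrow> real" where r: "inj r" "\<And>j. r j > 0" "\<And>j. r i \<le> r j"
      using ex_injective_pos[of i] by blast
    have rnz: "r i \<noteq> 0" for i using r(2)[of i] by simp
    obtain a' where a': "level_marking E a' \<in> maximal_marked_tubings E"
      "marking_refines (level_marking E a') (level_marking E a)"
      "\<And>i j. a i < a j \<Longrightarrow> a' i < a' j" "\<And>i j. a i = a j \<Longrightarrow> r i \<le> r j \<Longrightarrow> a' i \<le> a' j"
      by (rule ex_generic_perturbation[OF r(1) rnz, of a]) (rule that, blast+)
    have "marking_refines (level_marking E a') U'" using sub[OF a'(1)] a'(2) a by simp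
    then have t: "t \<in> level_tubes E a'" using \<open>t \<in> dom U'\<close> refines_dom by fastforce
    have "?w \<subseteq> t"
    proof (rule tube_subset_level_tube[OF symE t])
      show "tube E ?w" using level_tube_tube[OF symE w(1)] .
      show "?w \<inter> t \<noteq> {}" using w(2) i(1) by blast
      fix j assume "j \<in> ?w"
      then have "Min (a ` ?w) \<le> a j" by simp
      then have "a i \<le> a j" using Min_enclosing_level_tubes[OF symE tube, of a] i(2) by simp
      then have "a' i \<le> a' j" using a'(3,4)[of i j] r(3)[of j] by fastforce
      moreover have "Min (a' ` t) \<le> a' i" using i(1) by simp
      ultimately show "Min (a' ` t) \<le> a' j" by simp
    qed
    then show "t \<in> dom U" using w dom by auto
  next
    fix t assume t: "t \<in> dom U" and nb: "U' (enclosing (dom U') t) \<noteq> Some Broken"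
    let ?x = "U' (enclosing (dom U') t)"
    have x: "M t = ?x" if "M \<in> maximal_marked_tubings E" "marking_refines M U" for M
      using refinesD[OF sub[OF that] _ nb] refines_dom[OF that(2)] t by blast
    have tube: "tube E t" using level_tube_tube[OF symE] t dom by simp
    show "U t = ?x"
    proof (cases "U t = Some Broken")
      case False
      obtain M where M: "M \<in> maximal_marked_tubings E" "marking_refines M U"
        using ex_maximal_refinement[of a] a by blast
      have "M t = U t"
        using refinesD_self[OF M(2) t False] .
      then show ?thesis using x[OF M] by simp
    next
      case True
      then have Min0: "Min (a ` t) = 0"
        using a by (auto simp: level_marking_def sign_marking_def split: if_splits)
      \<comment> \<open>Pushing the zero minimum up makes \<open>t\<close> thin, pushing it down
        makes it thick, yet \<open>U'\<close> dictates the single mark \<open>?x\<close> to both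
        refinements.\<close>
      obtain r :: "'n \<Rightarrow> real" where r: "inj r" "\<And>j. r j > 0"
        using ex_injective_pos[of undefined] by blast
      have rnz: "r i \<noteq> 0" for i using r(2)[of i] by simp
    obtain a' where a': "level_marking E a' \<in> maximal_marked_tubings E"
        "marking_refines (level_marking E a') (level_marking E a)"
        "\<And>i. a i \<ge> 0 \<Longrightarrow> r i > 0 \<Longrightarrow> a' i > 0"
        by (rule ex_generic_perturbation[OF r(1) rnz, of a]) (rule that, blast+)
      have "a i \<ge> 0" if "i \<in> t" for i using Min_le[of "a ` t" "a i"] Min0 that by simp
      then have pos: "Min (a' ` t) > 0"
        using a'(3) r(2) tube_nonempty[OF tube] by simp
      have "inj (\<lambda>i. - r i)" "\<And>i. - r i \<noteq> 0" using r(1) rnz by (simp_all add: inj_def)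
      then obtain b where b: "level_marking E b \<in> maximal_marked_tubings E"
        "marking_refines (level_marking E b) (level_marking E a)"
        "\<And>i. a i \<le> 0 \<Longrightarrow> - r i < 0 \<Longrightarrow> b i < 0"
        by (rule ex_generic_perturbation[of "\<lambda>i. - r i" a]) (rule that, blast+)
      obtain i where "i \<in> t" "a i = 0" using Min_level_in[OF tube, of a] Min0 by metis
      then have "Min (b ` t) \<le> b i" "b i < 0" using b(3)[of i] r(2)[of i] by simp_all
      then have neg: "Min (b ` t) < 0" by simp
      have "level_marking E a' t = level_marking E b t"
        using x[OF a'(1)] x[OF b(1)] a'(2) b(2) a by simp
      moreover have "t \<in> level_tubes E a'" "t \<in> level_tubes E b"
        using refines_dom[OF a'(2)] refines_dom[OF b(2)] t dom by auto
      ultimately have "sign_marking (Min (a' ` t)) = sign_marking (Min (b ` t))"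
        by (simp add: level_marking_def)
      then show ?thesis using pos neg by (auto simp: sign_marking_def split: if_splits)
    qed
  qed
qed

end

section \<open>Moves\<close>

text \<open>Termination measure for sequences of moves: each move adds tubes or settles a broken
  one, and proper refinement raises the sum.\<close>

definition marking_rank :: "'n::finite marked \<Rightarrow> nat" where
  "marking_rank U = card (dom U) + card {t \<in> dom U. U t \<noteq> Some Broken}"

lemma marking_rank_le:
  fixes U :: "'n::finite marked"
  shows "marking_rank U \<le> 2 * CARD('n set)"
proof -
  have "card A \<le> CARD('n set)" for A :: "'n set set" by (rule card_mono) auto
  from add_mono[OF this this] show ?thesis by (simp add: marking_rank_def mult_2)
qed

lemma marking_rank_strict:
  assumes "marking_refines U U'" "U \<noteq> U'"
  shows "marking_rank U' < marking_rank U"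
proof (rule ccontr)
  let ?A = "\<lambda>U. {t \<in> dom U. U t \<noteq> Some Broken}"
  have dom: "dom U' \<subseteq> dom U" using assms(1) by (rule refines_dom)
  have sub: "?A U' \<subseteq> ?A U"
    using refinesD_self[OF assms(1)] dom by fastforce
  assume "\<not> ?thesis"
  moreover have "card (dom U') \<le> card (dom U)" "card (?A U') \<le> card (?A U)"
    using dom sub by (intro card_mono; simp)+
  ultimately have "card (dom U') = card (dom U)" "card (?A U') = card (?A U)"
    by (simp_all add: marking_rank_def)
  then have eq: "dom U' = dom U" "?A U' = ?A U"
    using dom sub by (simp_all add: card_subset_eq)
  have "U t = U' t" for t
  proof (cases "t \<in> ?A U'")
    case True
    then show ?thesis using refinesD_self[OF assms(1)] by blast
  next
    case False
    then have "t \<notin> ?A U" using eq(2) by simp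
    show ?thesis
    proof (cases "t \<in> dom U'")
      case True
      then show ?thesis using False \<open>t \<notin> ?A U\<close> eq(1) by simp
    next
      case False
      then have "t \<notin> dom U" using eq(1) by simp
      with False show ?thesis by (simp add: domIff)
    qed
  qed
  then show False using assms(2) by blast
qed

section \<open>Moves yield refinements, and refinements decompose into moves\<close>

context
  fixes E :: "'n::finite \<Rightarrow> 'n \<Rightarrow> bool"
begin

lemma marked_tubing_tubing: "marked_tubing E U \<Longrightarrow> tubing E (dom U)"
  by (simp add: marked_tubing_def)

lemma marked_tubing_thin:
  assumes "marked_tubing E U" "u \<in> dom U" "v \<in> dom U" "u \<subset> v" "U v \<noteq> Some Thick"
  shows "U u = Some Thin"
proof -
  have "\<forall>u\<in>dom U. \<forall>v\<in>dom U. u \<subset> v \<and> U v \<noteq> Some Thick \<longrightarrow> U u = Some Thin"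
    using assms(1) by (simp add: marked_tubing_def)
  from bspec[OF bspec[OF this assms(2)] assms(3)] assms(4,5) show ?thesis by blast
qed

lemma marked_tubing_mono:
  assumes "marked_tubing E U" "U v = Some m" "m \<noteq> Thick" "u \<in> dom U" "u \<subset> v"
  shows "U u = Some Thin"
  using assms by (intro marked_tubing_thin[of U u v]) auto

lemma marking_not_broken:
  assumes "t \<in> dom U" "U t \<noteq> Some Thin" "U t \<noteq> Some Thick"
  shows "U t = Some Broken"
proof -
  obtain m where "U t = Some m" using assms(1) by blast
  then show ?thesis using assms by (cases m) auto
qed

lemma marked_tube_nonempty: "marked_tubing E U \<Longrightarrow> t \<in> dom U \<Longrightarrow> t \<noteq> {}"
  by (rule tube_nonempty[OF tubing_tube[OF marked_tubing_tubing]])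

lemma enclosing_dom:
  assumes "marked_tubing E U" "marked_tubing E U'" "t \<in> dom U"
  shows "enclosing (dom U') t \<in> dom U'" "t \<subseteq> enclosing (dom U') t"
  by (rule enclosing_mem[OF marked_tubing_tubing[OF assms(2)] marked_tube_nonempty[OF assms(1,3)]],
      rule enclosing_upper)

lemma refines_upd:
  assumes u: "u \<in> dom U'" "U' u = Some Broken"
  shows "marking_refines (U'(u \<mapsto> m)) U'"
  unfolding marking_refines_def
proof (intro conjI ballI impI)
  have dom: "dom (U'(u \<mapsto> m)) = dom U'" using u(1) by auto
  then show "dom U' \<subseteq> dom (U'(u \<mapsto> m))" by simp
  fix t assume t: "t \<in> dom (U'(u \<mapsto> m))" and nb: "U' (enclosing (dom U') t) \<noteq> Some Broken"
  have e: "enclosing (dom U') t = t" using t unfolding dom by (rule enclosing_self)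
  then have "t \<noteq> u" using nb u(2) by metis
  then show "(U'(u \<mapsto> m)) t = U' (enclosing (dom U') t)" by (simp add: e)
qed

lemma refines_insert:
  assumes "u \<notin> dom U'" and m: "U' (enclosing (dom U') u) \<noteq> Some Broken \<Longrightarrow> U' (enclosing (dom U') u) = Some m"
  shows "marking_refines (U'(u \<mapsto> m)) U'"
  unfolding marking_refines_def
proof (intro conjI ballI impI)
  show "dom U' \<subseteq> dom (U'(u \<mapsto> m))" by auto
  fix t assume t: "t \<in> dom (U'(u \<mapsto> m))" "U' (enclosing (dom U') t) \<noteq> Some Broken"
  show "(U'(u \<mapsto> m)) t = U' (enclosing (dom U') t)"
  proof (cases "t = u")
    case True
    then show ?thesis using m t(2) by simp
  next
    case False
    then have "t \<in> dom U'" using t(1) by simp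
    then show ?thesis using False by (simp add: enclosing_self)
  qed
qed

text \<open>Each case comes down to identifying the smallest old tube around a newly added one and
  comparing the marks.\<close>

lemma tubing_move_refines:
  assumes "tubing_move E U' U" and U': "marked_tubing E U'"
  shows "marked_tubing E U \<and> marking_refines U U'"
  using assms(1)
proof cases
  case (resolve u m)
  then show ?thesis using refines_upd[of u U' m] by auto
next
  case (add_thin u v)
  have v: "v \<in> dom U'" using add_thin by auto
  let ?w = "enclosing (dom U') u"
  have w: "?w \<in> dom U'" by (rule enclosing_dom(1)[OF add_thin(5) U']) simp
  have "?w \<subseteq> v" using enclosing_least[OF v] add_thin(3) by blast
  then have "U' ?w = Some Thin \<or> U' ?w = Some Broken"
    using add_thin(4) marked_tubing_mono[OF U' _ _ w, of v] by (cases "?w = v") auto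
  then have "marking_refines (U'(u \<mapsto> Thin)) U'" using add_thin(2) by (intro refines_insert) auto
  then show ?thesis using add_thin by simp
next
  case (add_thick u v)
  have v: "v \<in> dom U'" using add_thick by auto
  let ?w = "enclosing (dom U') u"
  have w: "?w \<in> dom U'" "u \<subseteq> ?w"
    using enclosing_dom[OF add_thick(5) U', of u] by simp_all
  then have "u \<subset> ?w" using add_thick(2) by (metis psubsetI)
  then have "?w \<noteq> u" by blast
  then obtain m where m: "U' ?w = Some m" "(U'(u \<mapsto> Thick)) ?w = Some m" using w(1) by auto
  have "u \<in> dom (U'(u \<mapsto> Thick))" by simp
  \<comment> \<open>A thick tube may only lie inside thick tubes, so the result being a marked
    tubing forces the mark of \<open>?w\<close>.\<close>
  then have "m = Thick"
    using marked_tubing_mono[OF add_thick(5) m(2) _ _ \<open>u \<subset> ?w\<close>] by fastforce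
  then have "U' ?w = Some Thick" using m(1) by simp
  then have "marking_refines (U'(u \<mapsto> Thick)) U'" using add_thick(2) by (intro refines_insert) auto
  then show ?thesis using add_thick by simp
next
  case (add_broken C v)
  have vC: "v \<notin> C" using add_broken by auto
  then have domU: "dom U = dom U' \<union> C" using add_broken(4,5) by (auto split: if_splits)
  have "marking_refines U U'"
    unfolding marking_refines_def
  proof (intro conjI ballI impI)
    show "dom U' \<subseteq> dom U" using domU by blast
    fix t assume t: "t \<in> dom U" "U' (enclosing (dom U') t) \<noteq> Some Broken"
    show "U t = U' (enclosing (dom U') t)"
    proof (cases "t \<in> C")
      case True
      then have cn: "closely_nested (dom U) t v" using add_broken by blast
      have v: "v \<in> dom U'" using add_broken by blast
      have w: "enclosing (dom U') t \<in> dom U'" "t \<subseteq> enclosing (dom U') t"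
        using enclosing_dom[OF add_broken(7) U' t(1)] .
      \<comment> \<open>Close nesting leaves no tube strictly between \<open>t\<close> and
        \<open>v\<close>, so the smallest old tube around \<open>t\<close> is \<open>v\<close>,
        which was broken and hence imposes no mark.\<close>
      have "enclosing (dom U') t \<subseteq> v" using enclosing_least[OF v] cn by (auto simp: closely_nested_def)
      moreover have "enclosing (dom U') t \<noteq> t" using w(1) True add_broken(2) by fastforce
      ultimately have "enclosing (dom U') t \<subset> v \<and> t \<subset> enclosing (dom U') t"
        if "enclosing (dom U') t \<noteq> v"
        using that w(2) by (simp add: psubset_eq)
      moreover have "enclosing (dom U') t \<in> dom U" using w(1) domU by simp
      ultimately have "enclosing (dom U') t = v"
        using cn by (auto simp: closely_nested_def)
      then show ?thesis using t(2) add_broken(4) by simp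
    next
      case False
      then have "t \<in> dom U'" using t(1) domU by blast
      then have e: "enclosing (dom U') t = t" by (rule enclosing_self)
      then have "t \<noteq> v" using t(2) add_broken(4) by metis
      then show ?thesis using False add_broken(5) by (simp add: e)
    qed
  qed
  then show ?thesis using add_broken by simp
qed

text \<open>Everything inside a broken tube is already thin and everything around it already thick,
  so either mark is admissible.\<close>

lemma resolve_move:
  assumes U': "marked_tubing E U'" and u: "U' u = Some Broken" and m: "m = Thin \<or> m = Thick"
  shows "tubing_move E U' (U'(u \<mapsto> m))"
proof (rule tubing_move.resolve)
  have dom: "dom (U'(u \<mapsto> m)) = dom U'" using u by auto
  show "marked_tubing E (U'(u \<mapsto> m))"
    unfolding marked_tubing_def dom
  proof (intro conjI ballI impI)
    show "tubing E (dom U')" using U' by (rule marked_tubing_tubing)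
    fix s t assume st: "s \<in> dom U'" "t \<in> dom U'" "s \<subset> t \<and> (U'(u \<mapsto> m)) t \<noteq> Some Thick"
    show "(U'(u \<mapsto> m)) s = Some Thin"
    proof (cases "t = u")
      case True
      then show ?thesis using marked_tubing_mono[OF U' u _ st(1)] st(3) by auto
    next
      case False
      then have "U' t \<noteq> Some Thick" using st(3) by simp
      then have "U' s = Some Thin" using st(3) marked_tubing_thin[OF U' st(1,2)] by blast
      then show ?thesis using u by auto
    qed
  qed
qed (use assms in auto)

text \<open>Broken tubes of \<open>U'\<close> that \<open>U\<close> has settled are treated before
  tubes are added; when a missing tube is inserted, every broken tube of \<open>U'\<close> is
  therefore still broken in \<open>U\<close>, which determines the mark of the new tube.\<close>

lemma refines_step:
  assumes U: "marked_tubing E U" and U': "marked_tubing E U'" and ref: "marking_refines U U'" and ne: "U \<noteq> U'"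
  shows "\<exists>U''. tubing_move E U' U'' \<and> marking_refines U U''"
proof -
  have tub: "tubing E (dom U)" and tub': "tubing E (dom U')"
    using U U' by (auto dest: marked_tubing_tubing)
  have dom: "dom U' \<subseteq> dom U" using ref by (rule refines_dom)
  note encl = enclosing_dom[OF U U']
  have thin_below: "U t = Some Thin" if "t \<in> dom U" "U w = Some Thin" "t \<subseteq> w" for t w
    using marked_tubing_mono[OF U that(2) _ that(1)] that by (cases "t = w") auto
  consider
      (thin) v where "U' v = Some Broken" "U v = Some Thin"
    | (thick) v where "U' v = Some Broken" "U v = Some Thick"
    | (new) "\<And>v. U' v = Some Broken \<Longrightarrow> U v = Some Broken" "dom U' \<noteq> dom U"
    | (same) "\<And>v. U' v = Some Broken \<Longrightarrow> U v = Some Broken" "dom U' = dom U"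
    using marking_not_broken[of _ U] dom by blast
  then show ?thesis
  proof cases
    case thin
    have "marking_refines U (U'(v \<mapsto> Thin))"
      unfolding marking_refines_def
    proof (intro conjI ballI impI)
      have dom'': "dom (U'(v \<mapsto> Thin)) = dom U'" using thin by auto
      then show "dom (U'(v \<mapsto> Thin)) \<subseteq> dom U" using dom by simp
      fix t assume t: "t \<in> dom U"
        "(U'(v \<mapsto> Thin)) (enclosing (dom (U'(v \<mapsto> Thin))) t) \<noteq> Some Broken"
      then show "U t = (U'(v \<mapsto> Thin)) (enclosing (dom (U'(v \<mapsto> Thin))) t)"
        using thin_below[OF t(1) thin(2)] encl(2)[OF t(1)] refinesD[OF ref t(1)] dom''
        by (auto split: if_splits)
    qed
    then show ?thesis using resolve_move[OF U' thin(1)] by blast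
  next
    case thick
    \<comment> \<open>With \<open>v\<close> thick, every tube of \<open>U\<close> directly governed
      by \<open>v\<close> would have to be thick. \<open>D\<close> collects the offenders; its
      maximal members \<open>C\<close> are added as broken so that they govern the offenders
      instead.\<close>
    define D where "D = {t \<in> dom U. t \<notin> dom U' \<and> enclosing (dom U') t = v \<and> U t \<noteq> Some Thick}"
    define C where "C = {c \<in> D. \<forall>t\<in>D. c \<subseteq> t \<longrightarrow> t = c}"
    define U'' where "U'' = (\<lambda>t. if t \<in> C then Some Broken else (U'(v \<mapsto> Thick)) t)"
    have CD: "C \<subseteq> D" by (auto simp: C_def)
    have v: "v \<in> dom U'" using thick by auto
    have vC: "v \<notin> C" using v CD by (auto simp: D_def)
    have C': "c \<in> dom U" "c \<notin> dom U'" "enclosing (dom U') c = v" "c \<subset> v" if "c \<in> C" for c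
    proof -
      show c: "c \<in> dom U" "c \<notin> dom U'" "enclosing (dom U') c = v"
        using that CD by (auto simp: D_def)
      then show "c \<subset> v" using encl(2)[OF c(1)] v by auto
    qed
    have anti: "\<not> c \<subset> c'" if "c \<in> C" "c' \<in> C" for c c'
      using that CD by (auto simp: C_def)
    have dom'': "dom U'' = dom U' \<union> C"
      using v vC by (auto simp: U''_def split: if_splits)
    have sub: "dom U'' \<subseteq> dom U" using dom'' dom C'(1) by blast
    have tub'': "tubing E (dom U'')"
      using tubing_subset[OF tub sub] tubing_UNIV[OF tub'] dom'' by blast
    have above: "v \<subseteq> w" if "c \<in> C" "w \<in> dom U'" "c \<subseteq> w" for c w
      using enclosing_least[OF that(2,3)] C'(3)[OF that(1)] by simp
    have thick_above: "U' w = Some Thick" if "w \<in> dom U'" "v \<subset> w" for w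
      using marked_tubing_mono[OF U' _ _ v that(2)] that(1) thick(1) by fastforce
    have marked: "marked_tubing E U''"
      unfolding marked_tubing_def
    proof (intro conjI ballI impI tub'')
      fix s t assume s: "s \<in> dom U''" and t: "t \<in> dom U''" and st: "s \<subset> t \<and> U'' t \<noteq> Some Thick"
      have tv: "t \<noteq> v" using st vC by (auto simp: U''_def)
      show "U'' s = Some Thin"
      proof (cases "t \<in> C")
        case True
        then have "s \<notin> C" using anti st by blast
        then have s': "s \<in> dom U'" using s dom'' by blast
        have sv: "s \<subset> v" using st C'(4)[OF True] by blast
        then have "U' s = Some Thin" using marked_tubing_mono[OF U' thick(1) _ s'] by simp
        then show ?thesis using sv \<open>s \<notin> C\<close> by (auto simp: U''_def)
      next
        case False
        then have t': "t \<in> dom U'" "U' t \<noteq> Some Thick"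
          using t dom'' st tv by (auto simp: U''_def)
        have nvt: "\<not> v \<subset> t" using thick_above[OF t'(1)] t'(2) by blast
        have "s \<notin> C" using above[of s t] t'(1) st nvt tv by blast
        moreover have "s \<noteq> v" using nvt st by blast
        moreover have "s \<in> dom U'" using s dom'' \<open>s \<notin> C\<close> by simp
        then have "U' s = Some Thin" using st marked_tubing_thin[OF U' _ t'(1) _ t'(2)] by blast
        ultimately show ?thesis by (simp add: U''_def)
      qed
    qed
    have "marking_refines U U''"
      unfolding marking_refines_def
    proof (intro conjI ballI impI sub)
      fix t assume t: "t \<in> dom U" "U'' (enclosing (dom U'') t) \<noteq> Some Broken"
      let ?w = "enclosing (dom U'') t"
      have w: "?w \<in> dom U''" "t \<subseteq> ?w" using enclosing_dom[OF U marked t(1)] .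
      have "?w \<notin> C" using t(2) by (auto simp: U''_def)
      then have w': "?w \<in> dom U'" using w(1) dom'' by blast
      have e: "enclosing (dom U') t = ?w"
      proof (rule subset_antisym)
        show "enclosing (dom U') t \<subseteq> ?w" using enclosing_least[OF w' w(2)] .
        show "?w \<subseteq> enclosing (dom U') t"
          using encl[OF t(1)] dom'' by (intro enclosing_least) auto
      qed
      show "U t = U'' ?w"
      proof (cases "?w = v")
        case False
        then have "U'' ?w = U' ?w" using \<open>?w \<notin> C\<close> by (simp add: U''_def)
        then show ?thesis using refinesD[OF ref t(1)] e t(2) by simp
      next
        case True
        have "U t = Some Thick"
        proof (rule ccontr)
          assume nthick: "U t \<noteq> Some Thick"
          then have "t \<noteq> v" using thick(2) by auto
          have "t \<notin> dom U'" using enclosing_self[of t "dom U'"] e True \<open>t \<noteq> v\<close> by auto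
          \<comment> \<open>An offender lies below some maximal \<open>c\<close>, so
            \<open>c\<close> rather than \<open>v\<close> would be its smallest enclosing tube in
            \<open>dom U''\<close>.\<close>
          then have "t \<in> D" using nthick t(1) e True by (simp add: D_def)
          moreover obtain x where "x \<in> t" using tube_nonempty[OF tubing_tube[OF tub t(1)]] by blast
          ultimately obtain c where c: "c \<in> D" "t \<subseteq> c" "\<And>s. s \<in> D \<Longrightarrow> c \<subseteq> s \<Longrightarrow> s = c"
            using ex_maximal_member[of t D x] by blast
          then have cC: "c \<in> C" by (auto simp: C_def)
          then have "?w \<subseteq> c" using c(2) dom'' by (intro enclosing_least) auto
          then show False using True C'(4)[OF cC] by blast
        qed
        then show ?thesis using True vC by (simp add: U''_def)
      qed
    qed
    moreover have "tubing_move E U' U''"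
    proof (cases "C = {}")
      case True
      then have "U'' = U'(v \<mapsto> Thick)" by (auto simp: U''_def)
      then show ?thesis using resolve_move[OF U' thick(1)] by simp
    next
      case False
      show ?thesis
      proof (rule tubing_move.add_broken[OF False _ _ thick(1) U''_def _ marked])
        show "C \<inter> dom U' = {}" using C'(2) by blast
        show "pairwise (compatible E) C"
          using tub C'(1) unfolding tubing_def by (blast intro: pairwise_subset)
        show "\<forall>u\<in>C. closely_nested (dom U'') u v"
        proof
          fix c assume c: "c \<in> C"
          have "\<not> (c \<subset> w \<and> w \<subset> v)" if "w \<in> dom U''" for w
            using that above[OF c, of w] anti[OF c, of w] dom'' by blast
          then show "closely_nested (dom U'') c v"
            using c v C'(4) dom'' by (auto simp: closely_nested_def)
        qed
      qed
    qed
    ultimately show ?thesis by blast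
  next
    case new
    then obtain t where t: "t \<in> dom U" "t \<notin> dom U'" using dom by blast
    let ?v = "enclosing (dom U') t"
    have v: "?v \<in> dom U'" "t \<subseteq> ?v" using encl[OF t(1)] .
    then have tv: "t \<subset> ?v" using t(2) by auto
    \<comment> \<open>The mark is dictated by \<open>U\<close>: a \<open>?v\<close> that is not
      broken passes on its mark, while a broken \<open>?v\<close> is also broken in
      \<open>U\<close>, where everything strictly inside is thin.\<close>
    define m where "m = (if U' ?v = Some Thick then Thick else Thin)"
    have vm: "U' ?v = Some m \<or> U' ?v = Some Broken \<and> m = Thin"
      using marking_not_broken[OF v(1)] by (auto simp: m_def)
    have Ut: "U t = Some m"
    proof (cases "U' ?v = Some Broken")
      case False
      then show ?thesis using refinesD[OF ref t(1) False] vm by simp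
    next
      case True
      then have "U ?v = Some Broken" using new(1) by blast
      then show ?thesis using marked_tubing_mono[OF U _ _ t(1) tv] True by (simp add: m_def)
    qed
    let ?U = "U'(t \<mapsto> m)"
    have dom'': "dom ?U = insert t (dom U')" by auto
    have sub: "dom ?U \<subseteq> dom U" using dom t by auto
    have marked: "marked_tubing E ?U"
      unfolding marked_tubing_def
    proof (intro conjI ballI impI)
      show "tubing E (dom ?U)"
        using tubing_subset[OF tub sub] tubing_UNIV[OF tub'] dom'' by blast
      fix s w assume s: "s \<in> dom ?U" and w: "w \<in> dom ?U" and sw: "s \<subset> w \<and> ?U w \<noteq> Some Thick"
      have "s = t \<or> s \<in> dom U'" "w = t \<or> w \<in> dom U'" "s \<noteq> w" using s w sw by auto
      then consider "s = t" "w \<in> dom U'" "w \<noteq> t" | "w = t" "s \<in> dom U'" "s \<noteq> t"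
        | "s \<in> dom U'" "w \<in> dom U'" "s \<noteq> t" "w \<noteq> t"
        by blast
      then show "?U s = Some Thin"
      proof cases
        case 1
        then have "?v \<subseteq> w" using enclosing_least[of w "dom U'" t] sw by blast
        moreover have "U' w \<noteq> Some Thick" using sw 1 by auto
        ultimately have "U' ?v \<noteq> Some Thick"
          using marked_tubing_thin[OF U' v(1) 1(2)] by (cases "w = ?v") auto
        then show ?thesis using 1 by (simp add: m_def)
      next
        case 2
        then have "m = Thin" using sw vm by (auto simp: m_def split: if_splits)
        then have "U' ?v \<noteq> Some Thick" using vm by auto
        then have "U' s = Some Thin"
          using sw tv 2(1) marked_tubing_thin[OF U' 2(2) v(1)] psubset_trans by blast
        then show ?thesis using 2 by simp
      next
        case 3
        then have "U' w \<noteq> Some Thick" using sw by simp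
        then have "U' s = Some Thin" using sw marked_tubing_thin[OF U' 3(1,2)] by blast
        then show ?thesis using 3 by simp
      qed
    qed
    have "marking_refines U ?U"
      unfolding marking_refines_def
    proof (intro conjI ballI impI sub)
      fix s assume s: "s \<in> dom U" "?U (enclosing (dom ?U) s) \<noteq> Some Broken"
      let ?w = "enclosing (dom ?U) s"
      have w: "?w \<in> dom ?U" "s \<subseteq> ?w" using enclosing_dom[OF U marked s(1)] .
      show "U s = ?U ?w"
      proof (cases "?w = t")
        case False
        then have w': "?w \<in> dom U'" using w(1) dom'' by blast
        have "enclosing (dom U') s = ?w"
        proof (rule subset_antisym)
          show "enclosing (dom U') s \<subseteq> ?w" using enclosing_least[OF w' w(2)] .
          show "?w \<subseteq> enclosing (dom U') s"
            using encl[OF s(1)] dom'' by (intro enclosing_least) auto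
        qed
        then show ?thesis using refinesD[OF ref s(1)] s(2) False by simp
      next
        case True
        then have st: "s \<subseteq> t" using w(2) by simp
        have "U s = Some m"
        proof (cases "m = Thin")
          case True
          then show ?thesis using thin_below[OF s(1) _ st] Ut by simp
        next
          case False
          then have vt: "U' ?v = Some Thick" by (simp add: m_def split: if_splits)
          \<comment> \<open>A tube of \<open>U'\<close> around \<open>s\<close> contains
            \<open>t\<close>, the smallest tube around \<open>s\<close> after the insertion, and
            therefore contains \<open>?v\<close>.\<close>
          have "enclosing (dom U') s = ?v"
          proof (rule subset_antisym)
            show "enclosing (dom U') s \<subseteq> ?v" using st v by (intro enclosing_least) auto
            have "enclosing (dom U') s \<in> dom ?U" using encl(1)[OF s(1)] dom'' by blast
            then have "t \<subseteq> enclosing (dom U') s"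
              using enclosing_least[of _ "dom ?U" s] encl(2)[OF s(1)] True by blast
            then show "?v \<subseteq> enclosing (dom U') s" using encl(1)[OF s(1)] by (rule enclosing_least[rotated])
          qed
          then show ?thesis using refinesD[OF ref s(1)] vt vm by auto
        qed
        then show ?thesis using True by simp
      qed
    qed
    moreover have "tubing_move E U' ?U"
    proof (cases "U' ?v = Some Thick")
      case True
      then have "m = Thick" by (simp add: m_def)
      then show ?thesis using tubing_move.add_thick[OF t(2) tv True] marked by simp
    next
      case False
      then have "m = Thin" by (simp add: m_def)
      then show ?thesis using tubing_move.add_thin[OF t(2) tv] marked vm by auto
    qed
    ultimately show ?thesis by blast
  next
    case same
    have "U t = U' t" for t
    proof (cases "t \<in> dom U'")
      case True
      then show ?thesis
        using same(1)[of t] refinesD_self[OF ref True] by (cases "U' t = Some Broken") auto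
    next
      case False
      then have "t \<notin> dom U" using same(2) by simp
      with False show ?thesis by (simp add: domIff)
    qed
    then show ?thesis using ne by blast
  qed
qed

lemma tubing_move_neq: "tubing_move E U' U \<Longrightarrow> U \<noteq> U'"
proof (induction rule: tubing_move.induct)
  case (resolve u m)
  then have "(U'(u \<mapsto> m)) u \<noteq> U' u" by auto
  then show ?case by metis
next
  case (add_thin u v)
  then have "(U'(u \<mapsto> Thin)) u \<noteq> U' u" by (simp add: domIff)
  then show ?case by metis
next
  case (add_thick u v)
  then have "(U'(u \<mapsto> Thick)) u \<noteq> U' u" by (simp add: domIff)
  then show ?case by metis
next
  case (add_broken C v U)
  then have "v \<notin> C" by auto
  then have "U v \<noteq> U' v" using add_broken by simp
  then show ?case by metis
qed

text \<open>For the converse, \<open>refines_step\<close> is iterated; the rank grows with each move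
  and is bounded by \<open>marking_rank_le\<close>.\<close>

lemma marked_le_iff_refines:
  assumes "marked_tubing E U" "marked_tubing E U'"
  shows "marked_le E U U' \<longleftrightarrow> marking_refines U U'"
proof
  assume "marked_le E U U'"
  then have "(tubing_move E)\<^sup>*\<^sup>* U' U" by (simp add: marked_le_def)
  then have "marked_tubing E U \<and> marking_refines U U'"
  proof induction
    case base
    show ?case using assms(2) by (auto simp: marking_refines_def enclosing_self)
  next
    case (step V W)
    then have "marked_tubing E W \<and> marking_refines W V" using tubing_move_refines by blast
    then show ?case
      using step refines_trans[of E W V U'] assms(2) marked_tubing_tubing by blast
  qed
  then show "marking_refines U U'" by blast
next
  assume "marking_refines U U'"
  with assms(2) have "(tubing_move E)\<^sup>*\<^sup>* U' U"
  proof (induction U' rule: measure_induct_rule[of "\<lambda>V. 2 * CARD('n set) - marking_rank V"])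
    case (less V)
    show ?case
    proof (cases "U = V")
      case False
      obtain W where W: "tubing_move E V W" "marking_refines U W"
        using refines_step[OF assms(1) less.prems False] by blast
      have W': "marked_tubing E W" "marking_refines W V"
        using tubing_move_refines[OF W(1) less.prems(1)] by blast+
      have "marking_rank V < marking_rank W"
        using marking_rank_strict[OF W'(2)] tubing_move_neq[OF W(1)] by blast
      then have "2 * CARD('n set) - marking_rank W < 2 * CARD('n set) - marking_rank V"
        using marking_rank_le[of W] by linarith
      then have "(tubing_move E)\<^sup>*\<^sup>* W U" using less.IH W'(1) W(2) by blast
      with W(1) show ?thesis by (rule converse_rtranclp_into_rtranclp)
    qed simp
  qed
  then show "marked_le E U U'" by (simp add: marked_le_def)
qed

end

section \<open>Weights of maximal marked tubings\<close>

text \<open>Merging blocks of sizes \<open>p + 1\<close> and \<open>q + 1\<close> gives exponent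
  \<open>p + q + 1\<close>, one factor 3 against two summands of size at most
  \<open>3 ^ (p + q)\<close>.\<close>

lemma sum_power3_le:
  assumes "finite F" "F \<noteq> {}" "\<And>c. c \<in> F \<Longrightarrow> k c \<ge> 1"
  shows "(\<Sum>c\<in>F. (3::real) ^ (k c - 1)) \<le> 3 ^ (sum k F - 1)"
  using assms
proof (induction F rule: finite_ne_induct)
  case (insert c F)
  have "k c \<ge> 1" using insert.prems by simp
  then obtain p where p: "k c = Suc p" by (cases "k c") auto
  obtain c' where c': "c' \<in> F" using insert.hyps by blast
  then have "k c' \<ge> 1" "k c' \<le> sum k F"
    using insert.prems insert.hyps by (auto intro: member_le_sum)
  then obtain q where q: "sum k F = Suc q" by (cases "sum k F") auto
  have "(\<Sum>c\<in>insert c F. (3::real) ^ (k c - 1)) \<le> 3 ^ p + 3 ^ q"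
    using insert p q by simp
  also have "\<dots> \<le> 3 ^ (p + q) + 3 ^ (p + q)"
    by (intro add_mono power_increasing) auto
  also have "\<dots> \<le> 3 ^ (Suc p + Suc q - 1)" by simp
  finally show ?case using insert.hyps p q by simp
qed simp

text \<open>On \<open>W\<close>, \<open>g s\<close> is the distance from \<open>s\<close> to its
  predecessor; at the least element, which has none, it is set to 1. These are the layer weights for
  the summation over levels.\<close>

lemma gap_function:
  fixes W :: "real set"
  assumes "finite W"
  shows "\<exists>g. (\<forall>s. g s > 0) \<and> (\<forall>x\<in>W. \<forall>y\<in>W. x \<le> y \<longrightarrow> y - x = (\<Sum>s | s \<in> W \<and> x < s \<and> s \<le> y. g s))"
  using assms
proof (induction rule: finite_linorder_max_induct)
  case empty
  show ?case by (intro exI[of _ "\<lambda>_. 1"]) simp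
next
  case (insert b A)
  then obtain g where g: "\<And>s. g s > 0"
    "\<And>x y. x \<in> A \<Longrightarrow> y \<in> A \<Longrightarrow> x \<le> y \<Longrightarrow> y - x = (\<Sum>s | s \<in> A \<and> x < s \<and> s \<le> y. g s)"
    by blast
  define h where "h = g(b := if A = {} then 1 else b - Max A)"
  have "h s > 0" for s using g(1)[of s] insert.hyps by (auto simp: h_def)
  moreover have "y - x = (\<Sum>s | s \<in> insert b A \<and> x < s \<and> s \<le> y. h s)"
    if xy: "x \<in> insert b A" "y \<in> insert b A" "x \<le> y" for x y
  proof -
    have bA: "b \<notin> A" using insert.hyps by auto
    have hA: "sum h {s \<in> A. P s} = sum g {s \<in> A. P s}" for P
      using bA by (intro sum.cong) (auto simp: h_def)
    show ?thesis
    proof (cases "y = b")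
      case False
      then have "y \<in> A" "x \<in> A" using xy insert.hyps by (auto dest: bspec leD)
      moreover have "{s. s \<in> insert b A \<and> x < s \<and> s \<le> y} = {s \<in> A. x < s \<and> s \<le> y}"
        using \<open>y \<in> A\<close> insert.hyps by (auto dest: bspec leD)
      ultimately show ?thesis using g(2)[of x y] xy(3) hA by simp
    next
      case yb: True
      show ?thesis
      proof (cases "x = b")
        case True
        then have "{s. s \<in> insert b A \<and> x < s \<and> s \<le> y} = {}" using yb by auto
        then show ?thesis using True yb by (simp only: sum.empty)
      next
        case False
        then have x: "x \<in> A" using xy(1) by simp
        have max: "Max A \<in> A" "x \<le> Max A"
          using insert.hyps(1) x by (auto intro!: Max_in)
        have "{s. s \<in> insert b A \<and> x < s \<and> s \<le> y} = insert b {s \<in> A. x < s \<and> s \<le> Max A}"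
          using yb x insert.hyps by (auto dest: bspec)
        then have "(\<Sum>s | s \<in> insert b A \<and> x < s \<and> s \<le> y. h s) = h b + sum h {s \<in> A. x < s \<and> s \<le> Max A}"
          using insert.hyps bA by simp
        also have "\<dots> = (b - Max A) + (Max A - x)"
          using hA g(2)[OF x max] x by (auto simp: h_def)
        finally show ?thesis using yb by simp
      qed
    qed
  qed
  ultimately show ?case by blast
qed

lemma sum_eq_iff_pointwise:
  fixes f g :: "'a \<Rightarrow> real"
  assumes "finite A" "\<And>i. i \<in> A \<Longrightarrow> f i \<le> g i"
  shows "sum f A = sum g A \<longleftrightarrow> (\<forall>i\<in>A. f i = g i)"
  using sum_mono_inv[of f A g] assms by (auto intro: sum.cong)

section \<open>The function \<rho> and the bounds on vertex coordinates\<close>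

definition part_rank :: "('n::finite \<Rightarrow> 'n \<Rightarrow> bool) \<Rightarrow> 'n set \<Rightarrow> real" where
  "part_rank E B = (\<Sum>t\<in>parts E B. 3 ^ (card t - 1))"

lemma part_rank_UNIV [simp]: "part_rank E UNIV = 3 ^ (CARD('n) - 1)"
  for E :: "'n::finite \<Rightarrow> 'n \<Rightarrow> bool"
  by (simp add: part_rank_def parts_def)

context
  fixes E :: "'n::finite \<Rightarrow> 'n \<Rightarrow> bool" and M :: "'n marked"
  assumes symE: "symp E" and M: "M \<in> maximal_marked_tubings E"
begin

lemma maximal_tubing: "tubing E (dom M)"
  and maximal_marked: "marked_tubing E M"
  using M by (auto simp: maximal_marked_tubings_def marked_tubing_def)

lemma maximal_marks: "t \<in> dom M \<Longrightarrow> M t = Some Thin \<or> M t = Some Thick"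
  using M by (force simp: maximal_marked_tubings_def ran_def)

lemma enclosing_node:
  "enclosing (dom M) {i} \<in> dom M" "i \<in> enclosing (dom M) {i}"
  using enclosing_mem[OF maximal_tubing, of "{i}"] enclosing_upper[of "{i}" "dom M"] by auto

text \<open>The map from nodes to smallest tubes is onto, and here there are as many tubes as nodes.
  So each tube has exactly one own node.\<close>

lemma inj_enclosing: "inj (\<lambda>i. enclosing (dom M) {i})"
  using M enclosing_surj[OF symE maximal_tubing]
  by (intro eq_card_imp_inj_on) (simp_all add: maximal_marked_tubings_def)

lemma closely_nested_disjoint:
  assumes "closely_nested (dom M) s t" "closely_nested (dom M) s' t" "s \<noteq> s'"
  shows "s \<inter> s' = {}"
proof (rule ccontr)
  assume "s \<inter> s' \<noteq> {}"
  then have "s \<subseteq> s' \<or> s' \<subseteq> s"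
    using assms by (intro tubing_laminar[OF maximal_tubing]) (auto simp: closely_nested_def)
  then have "s \<subset> s' \<or> s' \<subset> s" using assms(3) by blast
  then show False using assms(1,2) unfolding closely_nested_def by blast
qed

text \<open>Any other node of \<open>t\<close> has a smallest tube strictly inside \<open>t\<close>,
  hence lies in a maximal such tube.\<close>

lemma tube_decomposition:
  assumes i: "enclosing (dom M) {i} = t"
  shows "t = insert i (\<Union>{s. closely_nested (dom M) s t})" "i \<notin> \<Union>{s. closely_nested (dom M) s t}"
proof -
  have t: "t \<in> dom M" "i \<in> t" using enclosing_node[of i] i by auto
  show "i \<notin> \<Union>{s. closely_nested (dom M) s t}"
  proof
    assume "i \<in> \<Union>{s. closely_nested (dom M) s t}"
    then obtain s where s: "closely_nested (dom M) s t" "i \<in> s" by blast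
    then have "t \<subseteq> s" using enclosing_least[of s "dom M" "{i}"] i by (auto simp: closely_nested_def)
    then show False using s(1) by (auto simp: closely_nested_def)
  qed
  show "t = insert i (\<Union>{s. closely_nested (dom M) s t})"
  proof
    show "insert i (\<Union>{s. closely_nested (dom M) s t}) \<subseteq> t"
      using t by (auto simp: closely_nested_def)
    show "t \<subseteq> insert i (\<Union>{s. closely_nested (dom M) s t})"
    proof
      fix j assume j: "j \<in> t"
      show "j \<in> insert i (\<Union>{s. closely_nested (dom M) s t})"
      proof (cases "j = i")
        case False
        let ?u = "enclosing (dom M) {j}"
        have "?u \<subseteq> t" using j t(1) by (intro enclosing_least) auto
        moreover have "?u \<noteq> t" using inj_enclosing False i by (auto dest: injD)
        ultimately have u: "?u \<in> {s \<in> dom M. s \<subset> t}" using enclosing_node(1) by blast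
        obtain w where w: "w \<in> {s \<in> dom M. s \<subset> t}" "?u \<subseteq> w"
          "\<And>v. v \<in> {s \<in> dom M. s \<subset> t} \<Longrightarrow> w \<subseteq> v \<Longrightarrow> v = w"
          by (rule ex_maximal_member[OF u enclosing_node(2)]) (rule that)
        have "closely_nested (dom M) w t"
          using w(1) w(3) t(1) unfolding closely_nested_def by blast
        then show ?thesis using w(2) enclosing_node(2)[of j] by blast
      qed simp
    qed
  qed
qed

lemma tube_weight_eq:
  assumes "enclosing (dom M) {i} = t"
  shows "tube_weight M i = 3 ^ (card t - 1) - (\<Sum>s | closely_nested (dom M) s t. 3 ^ (card s - 1))"
  using assms by (simp add: tube_weight_def smallest_tube_eq[OF maximal_tubing])

text \<open>The weight of the own node subtracts precisely the totals of the subtubes, so the sum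
  telescopes.\<close>

lemma sum_tube_weight:
  assumes "t \<in> dom M"
  shows "(\<Sum>i\<in>t. tube_weight M i) = 3 ^ (card t - 1)"
  using assms
proof (induction "card t" arbitrary: t rule: less_induct)
  case less
  let ?C = "{s. closely_nested (dom M) s t}"
  obtain i where i: "enclosing (dom M) {i} = t"
    using tube_own_node[OF symE maximal_tubing less.prems] by blast
  have "(\<Sum>j\<in>t. tube_weight M j) = tube_weight M i + (\<Sum>j\<in>\<Union>?C. tube_weight M j)"
    using tube_decomposition[OF i] sum.insert[of "\<Union>?C" i "tube_weight M"] by simp
  also have "(\<Sum>j\<in>\<Union>?C. tube_weight M j) = (\<Sum>s\<in>?C. \<Sum>j\<in>s. tube_weight M j)"
  proof -
    have "\<forall>A\<in>?C. \<forall>B\<in>?C. A \<noteq> B \<longrightarrow> A \<inter> B = {}"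
      using closely_nested_disjoint by simp
    then show ?thesis using sum.Union_disjoint[of ?C "tube_weight M"] by simp
  qed
  also have "\<dots> = (\<Sum>s\<in>?C. 3 ^ (card s - 1))"
    by (intro sum.cong refl less.hyps) (auto simp: closely_nested_def psubset_card_mono)
  finally show ?case using tube_weight_eq[OF i] by simp
qed

text \<open>With \<open>l + 2\<close> nodes in \<open>t\<close>, the subtubes share
  \<open>l + 1\<close> and take away at most \<open>3 ^ l\<close>; at least \<open>2 * 3 ^ l\<close>
  remains, against \<open>3 ^ (k - 1) \<le> 3 ^ l\<close>.\<close>

lemma tube_weight_gt:
  assumes i: "enclosing (dom M) {i} = t" and k: "1 \<le> k" "k < card t"
  shows "3 ^ (k - 1) < tube_weight M i"
proof -
  let ?C = "{s. closely_nested (dom M) s t}"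
  have tw: "tube_weight M i = 3 ^ (card t - 1) - (\<Sum>s\<in>?C. 3 ^ (card s - 1))"
    using tube_weight_eq[OF i] .
  define l where "l = card t - 2"
  then have l: "card t = Suc (Suc l)" using k by simp
  have kl: "(3::real) ^ (k - 1) \<le> 3 ^ l" using k l by (intro power_increasing) auto
  show ?thesis
  proof (cases "?C = {}")
    case True
    then have "tube_weight M i = 3 * 3 ^ l" using tw l by simp
    moreover have "(0::real) < 3 ^ l" by simp
    ultimately show ?thesis using kl by linarith
  next
    case False
    have "card t = Suc (card (\<Union>?C))"
      using tube_decomposition[OF i] card_insert_disjoint[of "\<Union>?C" i] by simp
    moreover have "card (\<Union>?C) = (\<Sum>s\<in>?C. card s)"
      using closely_nested_disjoint
      by (intro card_Union_disjoint) (auto simp: pairwise_def disjnt_def)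
    ultimately have "(\<Sum>s\<in>?C. card s) = Suc l" using l by simp
    moreover have "card s \<ge> 1" if "s \<in> ?C" for s
      using marked_tube_nonempty[OF maximal_marked, of s] that
      by (auto simp: closely_nested_def Suc_le_eq card_gt_0_iff)
    ultimately have "(\<Sum>s\<in>?C. (3::real) ^ (card s - 1)) \<le> 3 ^ l"
      using sum_power3_le[OF _ False, of card] by simp
    moreover have "tube_weight M i = 3 * 3 ^ l - (\<Sum>s\<in>?C. 3 ^ (card s - 1))"
      using tw l by simp
    moreover have "(0::real) < 3 ^ l" by simp
    ultimately show ?thesis using kl by linarith
  qed
qed

lemma tube_weight_pos: "tube_weight M i > 0"
proof -
  let ?t = "enclosing (dom M) {i}"
  show ?thesis
  proof (cases "1 < card ?t")
    case True
    then show ?thesis using tube_weight_gt[OF refl, of 1 i] by simp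
  next
    case False
    then have "\<forall>x\<in>?t. \<forall>y\<in>?t. x = y" using card_le_Suc0_iff_eq[of ?t] by simp
    then have "?t = {i}" using enclosing_node(2)[of i] by blast
    then have "(\<Sum>j\<in>{i}. tube_weight M j) = 1"
      using sum_tube_weight[OF enclosing_node(1)[of i]] by simp
    then show ?thesis by simp
  qed
qed

text \<open>The own node of the smallest member \<open>?S\<close> around \<open>t\<close> lies in
  \<open>t\<close>, since otherwise the connected \<open>t\<close> would fit into a single subtube
  of \<open>?S\<close>. Its weight alone exceeds the bound.\<close>

lemma sum_tube_weight_gt:
  assumes "tube E t" "t \<notin> dom M"
  shows "3 ^ (card t - 1) < (\<Sum>i\<in>t. tube_weight M i)"
proof -
  have ne: "t \<noteq> {}" using assms(1) by (rule tube_nonempty)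
  let ?S = "enclosing (dom M) t" 
  let ?C = "{s. closely_nested (dom M) s ?S}"
  have S: "?S \<in> dom M" "t \<subseteq> ?S" by (rule enclosing_mem[OF maximal_tubing ne], rule enclosing_upper)
  then have tS: "t \<subset> ?S" using assms(2) by auto
  have con: "connected_on E t" using assms tubing_UNIV[OF maximal_tubing] by (auto simp: tube_def)
  obtain i where i: "enclosing (dom M) {i} = ?S"
    using tube_own_node[OF symE maximal_tubing S(1)] by blast
  have "i \<in> t"
  proof (rule ccontr)
    assume "i \<notin> t"
    moreover have "t \<subseteq> insert i (\<Union>?C)"
      using S(2) equalityD1[OF tube_decomposition(1)[OF i]] by (rule subset_trans)
    ultimately have sub: "t \<subseteq> \<Union>?C" by (simp add: subset_insert)
    have C: "?C \<subseteq> dom M" by (auto simp: closely_nested_def)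
    obtain u where u: "u \<in> ?C" "t \<subseteq> u" using connected_subset_tube[OF symE maximal_tubing C con sub] .
    then have "?S \<subseteq> u" using C by (intro enclosing_least) auto
    then show False using u(1) by (auto simp: closely_nested_def)
  qed
  have "3 ^ (card t - 1) < tube_weight M i"
    using tS ne by (intro tube_weight_gt[OF i] psubset_card_mono) (auto simp: Suc_le_eq card_gt_0_iff)
  also have "\<dots> \<le> (\<Sum>j\<in>t. tube_weight M j)"
    using \<open>i \<in> t\<close> tube_weight_pos by (intro member_le_sum) (auto intro: less_imp_le)
  finally show ?thesis .
qed

lemma part_rank_le_sum_weight: "part_rank E B \<le> (\<Sum>i\<in>B. tube_weight M i)"
  and part_rank_eq_sum_weight:
    "part_rank E B = (\<Sum>i\<in>B. tube_weight M i) \<longleftrightarrow> parts E B \<subseteq> dom M"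
proof -
  have "\<forall>t\<in>parts E B. \<forall>u\<in>parts E B. t \<noteq> u \<longrightarrow> t \<inter> u = {}"
    using parts_eqI[OF symE] by blast
  then have "(\<Sum>i\<in>\<Union>(parts E B). tube_weight M i) = (\<Sum>t\<in>parts E B. \<Sum>i\<in>t. tube_weight M i)"
    using sum.Union_disjoint[of "parts E B" "tube_weight M"] by simp
  then have split: "(\<Sum>i\<in>B. tube_weight M i) = (\<Sum>t\<in>parts E B. \<Sum>i\<in>t. tube_weight M i)"
    by (simp add: Union_parts[OF symE])
  have tube: "tube E t" if "t \<in> parts E B" for t using tube_part[OF symE that] .
  have le: "3 ^ (card t - 1) \<le> (\<Sum>i\<in>t. tube_weight M i)" if "t \<in> parts E B" for t
    using sum_tube_weight[of t] sum_tube_weight_gt[OF tube[OF that]] by (cases "t \<in> dom M") auto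
  show "part_rank E B \<le> (\<Sum>i\<in>B. tube_weight M i)"
    unfolding split part_rank_def by (intro sum_mono le)
  have "part_rank E B = (\<Sum>i\<in>B. tube_weight M i) \<longleftrightarrow>
      (\<forall>t\<in>parts E B. 3 ^ (card t - 1) = (\<Sum>i\<in>t. tube_weight M i))"
    unfolding split part_rank_def using le by (intro sum_eq_iff_pointwise) auto
  also have "\<dots> \<longleftrightarrow> parts E B \<subseteq> dom M"
  proof -
    have "3 ^ (card t - 1) = (\<Sum>i\<in>t. tube_weight M i) \<longleftrightarrow> t \<in> dom M" if "t \<in> parts E B" for t
      using sum_tube_weight[of t] sum_tube_weight_gt[OF tube[OF that]] by (cases "t \<in> dom M") auto
    then show ?thesis by blast
  qed
  finally show "part_rank E B = (\<Sum>i\<in>B. tube_weight M i) \<longleftrightarrow> parts E B \<subseteq> dom M" .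
qed

lemma vertex_point_nth:
  "vertex_point M $ i =
    (if M (enclosing (dom M) {i}) = Some Thick then 3 * tube_weight M i else tube_weight M i)"
  by (simp add: vertex_point_def smallest_tube_eq[OF maximal_tubing])

text \<open>Slack has two sources, parts outside the tubing and thick coordinates. Both vanish
  exactly when the parts are thin tubes, because a thin tube contains only thin ones and each tube
  shows its mark at its own node.\<close>

lemma lower_bound: "part_rank E B \<le> (\<Sum>i\<in>B. vertex_point M $ i)"
  and lower_bound_eq: "part_rank E B = (\<Sum>i\<in>B. vertex_point M $ i) \<longleftrightarrow>
    (\<forall>t\<in>parts E B. M t = Some Thin)"
proof -
  have le: "tube_weight M i \<le> vertex_point M $ i" for i
    using tube_weight_pos[of i] by (simp add: vertex_point_nth)
  have sum_le: "(\<Sum>i\<in>B. tube_weight M i) \<le> (\<Sum>i\<in>B. vertex_point M $ i)"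
    by (intro sum_mono le)
  then show "part_rank E B \<le> (\<Sum>i\<in>B. vertex_point M $ i)"
    using part_rank_le_sum_weight[of B] by simp
  have "part_rank E B = (\<Sum>i\<in>B. vertex_point M $ i) \<longleftrightarrow>
      part_rank E B = (\<Sum>i\<in>B. tube_weight M i) \<and>
      (\<Sum>i\<in>B. tube_weight M i) = (\<Sum>i\<in>B. vertex_point M $ i)"
    using sum_le part_rank_le_sum_weight[of B] by auto
  also have "\<dots> \<longleftrightarrow> parts E B \<subseteq> dom M \<and> (\<forall>i\<in>B. tube_weight M i = vertex_point M $ i)"
    using sum_eq_iff_pointwise[of B "tube_weight M" "\<lambda>i. vertex_point M $ i"] le
    by (simp add: part_rank_eq_sum_weight)
  also have "\<dots> \<longleftrightarrow> parts E B \<subseteq> dom M \<and> (\<forall>i\<in>B. M (enclosing (dom M) {i}) \<noteq> Some Thick)"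
  proof -
    have "tube_weight M i = vertex_point M $ i \<longleftrightarrow> M (enclosing (dom M) {i}) \<noteq> Some Thick" for i
      using tube_weight_pos[of i] by (simp add: vertex_point_nth)
    then show ?thesis by simp
  qed
  also have "\<dots> \<longleftrightarrow> (\<forall>t\<in>parts E B. M t = Some Thin)"
  proof safe
    fix t assume *: "parts E B \<subseteq> dom M" "\<forall>i\<in>B. M (enclosing (dom M) {i}) \<noteq> Some Thick" "t \<in> parts E B"
    then have t: "t \<in> dom M" by blast
    obtain i where i: "i \<in> t" "enclosing (dom M) {i} = t" 
      using tube_own_node[OF symE maximal_tubing t] .
    then have "i \<in> B" using part_subset[OF symE *(3)] by blast
    then show "M t = Some Thin" using maximal_marks[OF t] *(2) i(2) by auto
  next
    fix i assume *: "\<forall>t\<in>parts E B. M t = Some Thin" "i \<in> B" "M (enclosing (dom M) {i}) = Some Thick"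
    then obtain t where t: "t \<in> parts E B" "i \<in> t" using Union_parts[OF symE, of B] by blast
    then have Mt: "M t = Some Thin" using * by blast
    then have "enclosing (dom M) {i} \<subseteq> t" using t(2) by (intro enclosing_least) auto
    then have "M (enclosing (dom M) {i}) = Some Thin"
      using marked_tubing_mono[OF maximal_marked Mt _ enclosing_node(1)[of i]] Mt
      by (cases "enclosing (dom M) {i} = t") auto
    then show False using * by simp
  qed auto
  finally show "part_rank E B = (\<Sum>i\<in>B. vertex_point M $ i) \<longleftrightarrow> (\<forall>t\<in>parts E B. M t = Some Thin)" .
qed

text \<open>The total weight is fixed, so a lower bound for the weights inside \<open>B\<close>
  bounds those outside from above; tripling covers the thick coordinates.\<close>

lemma upper_bound: "(\<Sum>i\<in>-B. vertex_point M $ i) \<le> 3 * (part_rank E UNIV - part_rank E B)"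
  and upper_bound_eq: "(\<Sum>i\<in>-B. vertex_point M $ i) = 3 * (part_rank E UNIV - part_rank E B) \<longleftrightarrow>
    parts E B \<subseteq> dom M \<and> (\<forall>i\<in>-B. M (enclosing (dom M) {i}) = Some Thick)"
proof -
  let ?f = "\<lambda>B. \<Sum>i\<in>B. tube_weight M i"
  have le: "vertex_point M $ i \<le> 3 * tube_weight M i" for i
    using tube_weight_pos[of i] by (simp add: vertex_point_nth)
  then have sum_le: "(\<Sum>i\<in>-B. vertex_point M $ i) \<le> (\<Sum>i\<in>-B. 3 * tube_weight M i)"
    by (intro sum_mono)
  have "?f B + ?f (- B) = ?f UNIV"
    using sum.subset_diff[of B UNIV "tube_weight M"] by (simp add: Compl_eq_Diff_UNIV)
  also have "?f UNIV = part_rank E UNIV"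
    using sum_tube_weight[OF tubing_UNIV[OF maximal_tubing]] by simp
  finally have compl: "(\<Sum>i\<in>-B. 3 * tube_weight M i) = 3 * (part_rank E UNIV - ?f B)"
    by (simp add: sum_distrib_left[symmetric])
  show "(\<Sum>i\<in>-B. vertex_point M $ i) \<le> 3 * (part_rank E UNIV - part_rank E B)"
    using sum_le compl part_rank_le_sum_weight[of B] by simp
  have "(\<Sum>i\<in>-B. vertex_point M $ i) = 3 * (part_rank E UNIV - part_rank E B) \<longleftrightarrow>
      part_rank E B = ?f B \<and> (\<Sum>i\<in>-B. vertex_point M $ i) = (\<Sum>i\<in>-B. 3 * tube_weight M i)"
    using sum_le compl part_rank_le_sum_weight[of B] by auto
  also have "\<dots> \<longleftrightarrow> parts E B \<subseteq> dom M \<and> (\<forall>i\<in>-B. vertex_point M $ i = 3 * tube_weight M i)"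
    using sum_eq_iff_pointwise[of "-B" "\<lambda>i. vertex_point M $ i" "\<lambda>i. 3 * tube_weight M i"] le
    by (simp add: part_rank_eq_sum_weight)
  also have "\<dots> \<longleftrightarrow> parts E B \<subseteq> dom M \<and> (\<forall>i\<in>-B. M (enclosing (dom M) {i}) = Some Thick)"
  proof -
    have "vertex_point M $ i = 3 * tube_weight M i \<longleftrightarrow> M (enclosing (dom M) {i}) = Some Thick" for i
      using tube_weight_pos[of i] by (simp add: vertex_point_nth)
    then show ?thesis by simp
  qed
  finally show "(\<Sum>i\<in>-B. vertex_point M $ i) = 3 * (part_rank E UNIV - part_rank E B) \<longleftrightarrow>
    parts E B \<subseteq> dom M \<and> (\<forall>i\<in>-B. M (enclosing (dom M) {i}) = Some Thick)" .
qed

end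

section \<open>Faces\<close>

text \<open>Each value \<open>a i\<close> is a signed sum of gaps between it and 0. Splitting at 0
  is exact because 0 is one of the levels.\<close>

lemma layer_cake:
  fixes a x :: "'n::finite \<Rightarrow> real"
  assumes W: "finite W" "0 \<in> W" "range a \<subseteq> W"
    and g: "\<And>x y. x \<in> W \<Longrightarrow> y \<in> W \<Longrightarrow> x \<le> y \<Longrightarrow> y - x = (\<Sum>s | s \<in> W \<and> x < s \<and> s \<le> y. g s)"
  shows "(\<Sum>i\<in>UNIV. a i * x i) =
    (\<Sum>s\<in>W. g s * (if s > 0 then \<Sum>i | s \<le> a i. x i else - (\<Sum>i | a i < s. x i)))"
proof -
  \<comment> \<open>Signed indicator of the gap ending at \<open>s\<close>. Gaps are half open, so
    the level 0 belongs to the negative side.\<close>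
  define w where "w s i = (if s > 0 then of_bool (s \<le> a i) else - of_bool (a i < s) :: real)" for s i
  have ai: "a i = (\<Sum>s\<in>W. g s * w s i)" for i
  proof (cases "0 \<le> a i")
    case True
    have "a i \<in> W" using W(3) by blast
    then have "a i = (\<Sum>s | s \<in> W \<and> 0 < s \<and> s \<le> a i. g s)" using g[OF W(2) _ True] by simp
    also have "\<dots> = (\<Sum>s\<in>W. g s * w s i)"
      using W(1) True by (intro sum.mono_neutral_cong_left) (auto simp: w_def)
    finally show ?thesis .
  next
    case False
    have "a i \<in> W" using W(3) by blast
    then have "a i = - (\<Sum>s | s \<in> W \<and> a i < s \<and> s \<le> 0. g s)" using g[OF _ W(2), of "a i"] False by simp
    also have "\<dots> = (\<Sum>s | s \<in> W \<and> a i < s \<and> s \<le> 0. g s * w s i)"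
      unfolding sum_negf[symmetric] by (intro sum.cong) (auto simp: w_def)
    also have "\<dots> = (\<Sum>s\<in>W. g s * w s i)"
      using W(1) False by (intro sum.mono_neutral_cong_left) (auto simp: w_def)
    finally show ?thesis .
  qed
  have level: "(\<Sum>i\<in>UNIV. w s i * x i) =
      (if s > 0 then \<Sum>i | s \<le> a i. x i else - (\<Sum>i | a i < s. x i))" for s
  proof (cases "s > 0")
    case True
    then have "(\<Sum>i\<in>UNIV. w s i * x i) = (\<Sum>i\<in>UNIV. if s \<le> a i then x i else 0)"
      by (intro sum.cong) (auto simp: w_def)
    then show ?thesis using True by (simp add: sum.If_cases)
  next
    case False
    then have "(\<Sum>i\<in>UNIV. w s i * x i) = - (\<Sum>i\<in>UNIV. if a i < s then x i else 0)"
      unfolding sum_negf[symmetric] by (intro sum.cong) (auto simp: w_def)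
    then show ?thesis using False by (simp add: sum.If_cases)
  qed
  have "(\<Sum>i\<in>UNIV. a i * x i) = (\<Sum>i\<in>UNIV. \<Sum>s\<in>W. g s * (w s i * x i))"
    by (subst ai) (simp add: sum_distrib_right mult.assoc)
  also have "\<dots> = (\<Sum>s\<in>W. g s * (\<Sum>i\<in>UNIV. w s i * x i))"
    by (subst sum.swap) (simp add: sum_distrib_left)
  finally show ?thesis unfolding level .
qed

text \<open>Both branches bound the contribution of one layer from below; for
  \<open>s \<le> 0\<close> this is the upper bound on the complement with its sign reversed.\<close>

definition level_bound :: "('n::finite \<Rightarrow> 'n \<Rightarrow> bool) \<Rightarrow> ('n \<Rightarrow> real) \<Rightarrow> real \<Rightarrow> real" where
  "level_bound E a s =
    (if s > 0 then part_rank E {i. s \<le> a i}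
     else - (3 * (part_rank E UNIV - part_rank E {i. s \<le> a i})))"

context
  fixes E :: "'n::finite \<Rightarrow> 'n \<Rightarrow> bool"
  assumes symE: "symp E"
begin

text \<open>Tight positive levels make the level tubes with positive minimum thin, the tight level 0
  makes the smallest tubes of negative nodes thick, and all levels put the level tubes into the
  tubing. The marking condition carries these marks to the remaining tubes of
  \<open>M\<close>.\<close>

lemma level_tight:
  fixes a :: "'n \<Rightarrow> real"
  assumes M: "M \<in> maximal_marked_tubings E"
    and W: "0 \<in> W" "range a \<subseteq> W"
  defines "v \<equiv> \<lambda>s. if s > 0 then \<Sum>i | s \<le> a i. vertex_point M $ i
    else - (\<Sum>i | a i < s. vertex_point M $ i)"
  shows "level_bound E a s \<le> v s"
    and "(\<forall>s\<in>W. level_bound E a s = v s) \<longleftrightarrow> marking_refines M (level_marking E a)"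
proof -
  have Cmpl: "{i. a i < s} = - {i. s \<le> a i}" for s by auto
  show "level_bound E a s \<le> v s"
    using lower_bound[OF symE M, of "{i. s \<le> a i}"] upper_bound[OF symE M, of "{i. s \<le> a i}"]
    by (simp add: level_bound_def v_def Cmpl)
  define pos where "pos s \<longleftrightarrow> (\<forall>t\<in>parts E {i. s \<le> a i}. M t = Some Thin)" for s
  define neg where "neg s \<longleftrightarrow> parts E {i. s \<le> a i} \<subseteq> dom M \<and>
      (\<forall>i. a i < s \<longrightarrow> M (enclosing (dom M) {i}) = Some Thick)" for s
  have tight: "level_bound E a s = v s \<longleftrightarrow> (if s > 0 then pos s else neg s)" for s
    using lower_bound_eq[OF symE M, of "{i. s \<le> a i}"] upper_bound_eq[OF symE M, of "{i. s \<le> a i}"]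
    by (auto simp: level_bound_def v_def Cmpl pos_def neg_def)
  have marked: "marked_tubing E M" using maximal_marked[OF symE M] .
  have "(\<forall>s\<in>W. if s > 0 then pos s else neg s) \<longleftrightarrow> marking_refines M (level_marking E a)"
  proof
    assume *: "\<forall>s\<in>W. if s > 0 then pos s else neg s"
    have level: "Min (a ` t) \<in> W" "t \<in> parts E {i. Min (a ` t) \<le> a i}" if t: "t \<in> level_tubes E a" for t
    proof -
      show "t \<in> parts E {i. Min (a ` t) \<le> a i}" using level_tube_part[OF symE t] .
      obtain i where "i \<in> t" "a i = Min (a ` t)"
        using Min_level_in[OF level_tube_tube[OF symE t]] .
      then show "Min (a ` t) \<in> W" using W(2) by (metis rangeI subsetD)
    qed
    have thin: "M t = Some Thin" if "t \<in> level_tubes E a" "Min (a ` t) > 0" for t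
      using bspec[OF * level(1)[OF that(1)]] level(2)[OF that(1)] that(2) by (simp add: pos_def)
    \<comment> \<open>The single level 0 reaches all negative values at once, which is where
      \<open>0 \<in> W\<close> enters.\<close>
    have thick: "M (enclosing (dom M) {i}) = Some Thick" if "a i < 0" for i
      using bspec[OF * W(1)] that by (simp add: neg_def)
    show "marking_refines M (level_marking E a)"
      unfolding marking_refines_def dom_level_marking
    proof (intro conjI ballI impI subsetI)
      fix t assume t: "t \<in> level_tubes E a"
      show "t \<in> dom M"
      proof (cases "Min (a ` t) > 0")
        case True
        then show ?thesis using thin[OF t] by blast
      next
        case False
        then show ?thesis using bspec[OF * level(1)[OF t]] level(2)[OF t] by (auto simp: neg_def)
      qed
    next
      fix t assume t: "t \<in> dom M"
        and nb: "level_marking E a (enclosing (level_tubes E a) t) \<noteq> Some Broken"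
      let ?w = "enclosing (level_tubes E a) t"
      have tube: "tube E t" using tubing_tube[OF marked_tubing_tubing[OF marked] t] .
      have w: "?w \<in> level_tubes E a" "t \<subseteq> ?w"
        by (rule enclosing_mem[OF tubing_level_tubes[OF symE] tube_nonempty[OF tube]],
            rule enclosing_upper)
      have Min: "Min (a ` ?w) = Min (a ` t)" using Min_enclosing_level_tubes[OF symE tube] .
      have mark: "level_marking E a ?w = Some (sign_marking (Min (a ` t)))"
        using w(1) Min by (simp add: level_marking_def)
      have "Min (a ` t) \<noteq> 0" using nb mark by (auto simp: sign_marking_def)
      then consider "Min (a ` t) > 0" | "Min (a ` t) < 0" by linarith
      then show "M t = level_marking E a ?w"
      proof cases
        case 1
        then have Mw: "M ?w = Some Thin" using thin[OF w(1)] Min by simp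
        have "M t = Some Thin"
          using marked_tubing_mono[OF marked Mw _ t] w(2) Mw by (cases "t = ?w") (auto simp: psubset_eq)
        then show ?thesis using mark 1 by (simp add: sign_marking_def)
      next
        case 2
        \<comment> \<open>The minimising node has a thick smallest tube inside \<open>t\<close>, and
          only a thick tube can contain a thick one.\<close>
        obtain i where i: "i \<in> t" "a i = Min (a ` t)" using Min_level_in[OF tube] .
        let ?u = "enclosing (dom M) {i}"
        have u: "M ?u = Some Thick" using thick[of i] i 2 by simp
        have ut: "?u \<subseteq> t" using t i(1) by (intro enclosing_least) auto
        have "M t = Some Thick"
        proof (cases "?u = t")
          case False
          then show ?thesis
            using marked_tubing_thin[OF marked enclosing_node(1)[OF symE M, of i] t] u ut by fastforce
        qed (use u in simp)
        then show ?thesis using mark 2 by (simp add: sign_marking_def)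
      qed
    qed
  next
    assume ref: "marking_refines M (level_marking E a)"
    have parts_level: "t \<in> level_tubes E a" if "t \<in> parts E {i. s \<le> a i}" for s t
      using that by (auto simp: level_tubes_def)
    have dom: "level_tubes E a \<subseteq> dom M" using refines_dom[OF ref] by simp
    have "pos s" if "s > 0" for s
      unfolding pos_def
    proof
      fix t assume t: "t \<in> parts E {i. s \<le> a i}"
      then have l: "t \<in> level_tubes E a" by (rule parts_level)
      obtain i where i: "i \<in> t" "a i = Min (a ` t)"
        using Min_level_in[OF level_tube_tube[OF symE l]] .
      then have "s \<le> Min (a ` t)" using part_subset[OF symE t] by auto
      then have "level_marking E a t = Some Thin"
        using l \<open>s > 0\<close> by (simp add: level_marking_def sign_marking_def)
      then show "M t = Some Thin" using refinesD_self[OF ref, of t] l by simp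
    qed
    moreover have "neg s" if "s \<le> 0" for s
      unfolding neg_def
    proof (intro conjI allI impI)
      show "parts E {i. s \<le> a i} \<subseteq> dom M" using parts_level dom by blast
      fix i assume i: "a i < s"
      let ?t = "enclosing (dom M) {i}"
      have t: "?t \<in> dom M" "i \<in> ?t" by (rule enclosing_node[OF symE M])+
      have tube: "tube E ?t" using tubing_tube[OF marked_tubing_tubing[OF marked] t(1)] .
      let ?w = "enclosing (level_tubes E a) ?t"
      have w: "?w \<in> level_tubes E a"
        by (rule enclosing_mem[OF tubing_level_tubes[OF symE] tube_nonempty[OF tube]])
      have "Min (a ` ?t) \<le> a i" using t(2) by simp
      then have "Min (a ` ?w) < 0"
        using i that Min_enclosing_level_tubes[OF symE tube, of a] by simp
      then have "level_marking E a ?w = Some Thick"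
        using w by (simp add: level_marking_def sign_marking_def)
      then show "M ?t = Some Thick" using refinesD[OF ref t(1)] by simp
    qed
    ultimately show "\<forall>s\<in>W. if s > 0 then pos s else neg s" by auto
  qed
  then show "(\<forall>s\<in>W. level_bound E a s = v s) \<longleftrightarrow> marking_refines M (level_marking E a)"
    using tight by simp
qed

text \<open>The layer weights are positive, so the total bound is attained only if every layer is
  tight. Existence of a maximal refinement later makes \<open>L\<close> the true minimum.\<close>

lemma vertex_minimizers:
  fixes a :: "real ^ 'n"
  obtains L where
    "\<And>M. M \<in> maximal_marked_tubings E \<Longrightarrow> L \<le> a \<bullet> vertex_point M"
    "\<And>M. M \<in> maximal_marked_tubings E \<Longrightarrow>
      a \<bullet> vertex_point M = L \<longleftrightarrow> marking_refines M (level_marking E (\<lambda>i. a $ i))"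
proof -
  define W where "W = insert 0 (range (\<lambda>i. a $ i))"
  have W: "finite W" "0 \<in> W" "range (\<lambda>i. a $ i) \<subseteq> W" by (auto simp: W_def)
  obtain g where g: "\<And>s. g s > 0"
    "\<And>x y. x \<in> W \<Longrightarrow> y \<in> W \<Longrightarrow> x \<le> y \<Longrightarrow> y - x = (\<Sum>s | s \<in> W \<and> x < s \<and> s \<le> y. g s)"
    using gap_function[OF W(1)] by blast
  define L where "L = (\<Sum>s\<in>W. g s * level_bound E (\<lambda>i. a $ i) s)"
  define v where "v M s = (if s > 0 then \<Sum>i | s \<le> a $ i. vertex_point M $ i
    else - (\<Sum>i | a $ i < s. vertex_point M $ i))" for M s
  have inner: "a \<bullet> vertex_point M = (\<Sum>s\<in>W. g s * v M s)" for M
    using layer_cake[OF W g(2), of "\<lambda>i. vertex_point M $ i"]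
    by (simp add: inner_vec_def v_def)
  have le: "g s * level_bound E (\<lambda>i. a $ i) s \<le> g s * v M s"
    if "M \<in> maximal_marked_tubings E" for M s
    using level_tight(1)[OF that W(2,3), of s] g(1)[of s]
    by (simp add: v_def mult_left_mono)
  show ?thesis
  proof (rule that[of L])
    fix M assume M: "M \<in> maximal_marked_tubings E"
    show "L \<le> a \<bullet> vertex_point M"
      unfolding inner L_def by (intro sum_mono le[OF M])
    have "g s \<noteq> 0" for s using g(1)[of s] by simp
    have "L = a \<bullet> vertex_point M \<longleftrightarrow> (\<forall>s\<in>W. g s * level_bound E (\<lambda>i. a $ i) s = g s * v M s)"
      unfolding inner L_def by (rule sum_eq_iff_pointwise[OF W(1) le[OF M]])
    also have "\<dots> \<longleftrightarrow> (\<forall>s\<in>W. level_bound E (\<lambda>i. a $ i) s = v M s)"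
      using \<open>\<And>s. g s \<noteq> 0\<close> by simp
    also have "\<dots> \<longleftrightarrow> marking_refines M (level_marking E (\<lambda>i. a $ i))"
      using level_tight(2)[OF M W(2,3)] by (simp add: v_def)
    finally show "a \<bullet> vertex_point M = L \<longleftrightarrow> marking_refines M (level_marking E (\<lambda>i. a $ i))"
      by auto
  qed
qed

end

section \<open>Faces as sets of minimisers, and the face poset\<close>

lemma face_convex_hull_minimizers:
  fixes a :: "'a::euclidean_space"
  assumes "finite A" "\<And>x. x \<in> A \<Longrightarrow> L \<le> a \<bullet> x"
  shows "convex hull A \<inter> {x. a \<bullet> x = L} = convex hull {x \<in> A. a \<bullet> x = L}"
    and "convex hull A \<inter> {x. a \<bullet> x = L} face_of convex hull A"
proof -
  have "convex hull A \<subseteq> {x. L \<le> a \<bullet> x}"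
    using assms(2) by (intro hull_minimal) (auto simp: convex_halfspace_ge)
  then show face: "convex hull A \<inter> {x. a \<bullet> x = L} face_of convex hull A"
    by (intro face_of_Int_supporting_hyperplane_ge) auto
  then obtain S where S: "S \<subseteq> A" "convex hull A \<inter> {x. a \<bullet> x = L} = convex hull S"
    using face_of_convex_hull_subset[OF finite_imp_compact[OF assms(1)]] by blast
  then have "S \<subseteq> {x \<in> A. a \<bullet> x = L}" using hull_subset[of S convex] by blast
  then have "convex hull A \<inter> {x. a \<bullet> x = L} \<subseteq> convex hull {x \<in> A. a \<bullet> x = L}"
    unfolding S(2) by (rule hull_mono)
  moreover have "convex hull {x \<in> A. a \<bullet> x = L} \<subseteq> {x. a \<bullet> x = L}"
    by (intro hull_minimal) (auto simp: convex_hyperplane)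
  moreover have "convex hull {x \<in> A. a \<bullet> x = L} \<subseteq> convex hull A" by (rule hull_mono) auto
  ultimately show "convex hull A \<inter> {x. a \<bullet> x = L} = convex hull {x \<in> A. a \<bullet> x = L}" by blast
qed

lemma finite_maximal_marked_tubings: "finite (maximal_marked_tubings E)"
  for E :: "'n::finite \<Rightarrow> 'n \<Rightarrow> bool"
proof (rule finite_subset)
  show "maximal_marked_tubings E \<subseteq> {U. dom U \<in> Pow UNIV \<and> ran U \<subseteq> {Thin, Thick}}"
    by (auto simp: maximal_marked_tubings_def)
  have "{U :: 'n marked. dom U \<in> Pow UNIV \<and> ran U \<subseteq> {Thin, Thick}} =
      (\<Union>A\<in>Pow UNIV. {U. dom U = A \<and> ran U \<subseteq> {Thin, Thick}})" by blast
  then show "finite {U :: 'n marked. dom U \<in> Pow UNIV \<and> ran U \<subseteq> {Thin, Thick}}"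
    by (simp add: finite_set_of_finite_maps)
qed

theorem theorem17:
  fixes E :: "'n::finite \<Rightarrow> 'n \<Rightarrow> bool"
  assumes "simple_graph E"
  shows "polytope (convex hull (vertex_point ` maximal_marked_tubings E)) \<and>
    (\<exists>\<phi>. bij_betw \<phi> {U. marked_tubing E U}
            {F. F face_of (convex hull (vertex_point ` maximal_marked_tubings E)) \<and> F \<noteq> {}} \<and>
         (\<forall>U U'. marked_tubing E U \<and> marked_tubing E U' \<longrightarrow>
            (marked_le E U U' \<longleftrightarrow> \<phi> U \<subseteq> \<phi> U')))"
proof -
  have symE: "symp E" using assms by (simp add: simple_graph_def)
  let ?M = "maximal_marked_tubings E"
  let ?A = "vertex_point ` ?M"
  let ?P = "convex hull ?A"
  define \<phi> where "\<phi> U = convex hull (vertex_point ` {M \<in> ?M. marking_refines M U})" for U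
  have finA: "finite ?A" using finite_maximal_marked_tubings by blast
  then have poly: "polytope ?P" by (rule polytope_convex_hull)
  have face: "?P \<inter> {x. a \<bullet> x = L} = \<phi> (level_marking E (\<lambda>i. a $ i)) \<and> 
      ?P \<inter> {x. a \<bullet> x = L} face_of ?P"
    if L: "\<And>M. M \<in> ?M \<Longrightarrow> L \<le> a \<bullet> vertex_point M"
      "\<And>M. M \<in> ?M \<Longrightarrow> a \<bullet> vertex_point M = L \<longleftrightarrow> marking_refines M (level_marking E (\<lambda>i. a $ i))" for a L
  proof -
    have A: "\<And>x. x \<in> ?A \<Longrightarrow> L \<le> a \<bullet> x" using L(1) by auto
    have "{x \<in> ?A. a \<bullet> x = L} = vertex_point ` {M \<in> ?M. marking_refines M (level_marking E (\<lambda>i. a $ i))}"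
      using L(2) by auto
    then have "?P \<inter> {x. a \<bullet> x = L} = \<phi> (level_marking E (\<lambda>i. a $ i))"
      using face_convex_hull_minimizers(1)[OF finA A] by (simp add: \<phi>_def)
    then show ?thesis using face_convex_hull_minimizers(2)[OF finA A] by blast
  qed
  have realize: "\<exists>a. level_marking E (\<lambda>i. a $ i) = U" if U: "marked_tubing E U" for U
  proof -
    obtain a where "level_marking E a = U" using marked_tubing_eq_level_marking[OF symE U] .
    then have "level_marking E (\<lambda>i. (\<chi> i. a i) $ i) = U" by simp
    then show ?thesis by blast
  qed
  \<comment> \<open>A vertex on the face of \<open>U\<close> attains the minimum of a functional
    whose level marking is \<open>U\<close>, and attaining it is equivalent to refining
    \<open>U\<close>.\<close>
  have mem: "marking_refines M U" if U: "marked_tubing E U" and M: "M \<in> ?M" "vertex_point M \<in> \<phi> U" for U M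
  proof -
    obtain a where a: "level_marking E (\<lambda>i. a $ i) = U" using realize[OF U] by blast
    obtain L where L: "\<And>M. M \<in> ?M \<Longrightarrow> L \<le> a \<bullet> vertex_point M"
      "\<And>M. M \<in> ?M \<Longrightarrow> a \<bullet> vertex_point M = L \<longleftrightarrow> marking_refines M (level_marking E (\<lambda>i. a $ i))"
      by (rule vertex_minimizers[OF symE, of a]) (rule that)
    have "\<phi> U \<subseteq> {x. a \<bullet> x = L}" using face[OF L] a by auto
    then show ?thesis using M L(2)[OF M(1)] a by auto
  qed
  have order: "marked_le E U U' \<longleftrightarrow> \<phi> U \<subseteq> \<phi> U'" if U: "marked_tubing E U" "marked_tubing E U'" for U U'
  proof -
    have "marking_refines U U' \<longleftrightarrow> \<phi> U \<subseteq> \<phi> U'"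
    proof
      assume ref: "marking_refines U U'"
      have "marking_refines M U'" if "M \<in> ?M" "marking_refines M U" for M
        using refines_trans[of E M U U', OF _ _ _ that(2) ref] maximal_marked[OF symE that(1)] U
        by (simp add: marked_tubing_tubing)
      then show "\<phi> U \<subseteq> \<phi> U'" unfolding \<phi>_def by (intro hull_mono) auto
    next
      assume sub: "\<phi> U \<subseteq> \<phi> U'"
      show "marking_refines U U'"
      proof (rule refines_if_maximal_refines[OF symE U])
        fix M assume M: "M \<in> ?M" "marking_refines M U"
        then have "vertex_point M \<in> \<phi> U" unfolding \<phi>_def by (intro hull_inc) auto
        then show "marking_refines M U'" using mem[OF U(2) M(1)] sub by blast
      qed
    qed
    then show ?thesis using marked_le_iff_refines[OF U] by simp
  qed
  have "bij_betw \<phi> {U. marked_tubing E U} {F. F face_of ?P \<and> F \<noteq> {}}"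
    unfolding bij_betw_def
  proof
    show "inj_on \<phi> {U. marked_tubing E U}"
    proof (rule inj_onI)
      fix U U' assume "U \<in> {U. marked_tubing E U}" "U' \<in> {U. marked_tubing E U}" "\<phi> U = \<phi> U'"
      then have "marked_le E U U'" "marked_le E U' U" using order by simp_all
      then show "U = U'"
        using marked_le_iff_refines \<open>U \<in> _\<close> \<open>U' \<in> _\<close> by (intro refines_antisym) auto
    qed
    show "\<phi> ` {U. marked_tubing E U} = {F. F face_of ?P \<and> F \<noteq> {}}"
    proof (intro subset_antisym subsetI)
      fix F assume "F \<in> \<phi> ` {U. marked_tubing E U}"
      then obtain U where U: "marked_tubing E U" "F = \<phi> U" by blast
      obtain a where a: "level_marking E (\<lambda>i. a $ i) = U" using realize[OF U(1)] by blast
      obtain L where L: "\<And>M. M \<in> ?M \<Longrightarrow> L \<le> a \<bullet> vertex_point M"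
        "\<And>M. M \<in> ?M \<Longrightarrow> a \<bullet> vertex_point M = L \<longleftrightarrow> marking_refines M (level_marking E (\<lambda>i. a $ i))"
        by (rule vertex_minimizers[OF symE, of a]) (rule that)
      have "?P \<inter> {x. a \<bullet> x = L} = F" "?P \<inter> {x. a \<bullet> x = L} face_of ?P"
        using face[OF L] unfolding U(2) a by blast+
      then have "F face_of ?P" by (simp only:)
      moreover obtain M where M: "M \<in> ?M" "marking_refines M (level_marking E (\<lambda>i. a $ i))"
        by (rule ex_maximal_refinement[OF symE, of "\<lambda>i. a $ i"]) (erule (1) that)
      have "vertex_point M \<in> F" using M unfolding U(2) \<phi>_def a by (intro hull_inc) auto
      ultimately show "F \<in> {F. F face_of ?P \<and> F \<noteq> {}}" by blast
    next
      fix F assume "F \<in> {F. F face_of ?P \<and> F \<noteq> {}}"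
      then have F: "F face_of ?P" "F \<noteq> {}" by auto
      \<comment> \<open>Faces of a polyhedron are exposed, so \<open>F\<close> is cut out by some
        functional, whose level marking is the preimage sought.\<close>
      then have "F exposed_face_of ?P"
        using exposed_face_of_polyhedron[OF polytope_imp_polyhedron[OF poly]] by simp
      then obtain c b where c: "?P \<subseteq> {x. c \<bullet> x \<le> b}" "F = ?P \<inter> {x. c \<bullet> x = b}"
        by (auto simp: exposed_face_of_def)
      \<comment> \<open>The exposing functional is maximal on \<open>F\<close>, while
        \<open>vertex_minimizers\<close> concerns minima.\<close>
      define a where "a = - c"
      obtain L where L: "\<And>M. M \<in> ?M \<Longrightarrow> L \<le> a \<bullet> vertex_point M"
        "\<And>M. M \<in> ?M \<Longrightarrow> a \<bullet> vertex_point M = L \<longleftrightarrow> marking_refines M (level_marking E (\<lambda>i. a $ i))"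
        by (rule vertex_minimizers[OF symE, of a]) (rule that)
      obtain M where M: "M \<in> ?M" "marking_refines M (level_marking E (\<lambda>i. a $ i))"
        by (rule ex_maximal_refinement[OF symE, of "\<lambda>i. a $ i"]) (erule (1) that)
      have "vertex_point M \<in> ?P" using M(1) by (intro hull_inc) auto
      \<comment> \<open>The supporting value is the minimum \<open>L\<close>: one inequality comes
        from a minimising vertex, the other from a point of the nonempty \<open>F\<close>.\<close>
      then have "- b \<le> L" using c(1) L(2)[OF M(1)] M(2) by (auto simp: a_def)
      moreover have "?P \<subseteq> {x. L \<le> a \<bullet> x}"
        using L(1) by (intro hull_minimal) (auto simp: convex_halfspace_ge)
      then have "L \<le> - b" using F(2) c(2) by (force simp: a_def)
      ultimately have "L = - b" by simp
      then have "F = ?P \<inter> {x. a \<bullet> x = L}" using c(2) by (auto simp: a_def)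
      then have "F = \<phi> (level_marking E (\<lambda>i. a $ i))" using face[OF L] by simp
      then show "F \<in> \<phi> ` {U. marked_tubing E U}"
        using marked_tubing_level_marking[OF symE] by blast
    qed
  qed
  then show ?thesis using poly order by blast
qed

end
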